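(* Let $(M,g,\Pi)$ be an $n$-dimensional compact Riemannian Poisson manifold with contravariant Levi-Civita connection $\mathcal{D}$, and let $\eta$ be a 2-Killing 1-form on $M$ with $\mathcal{D}_\eta\eta=0$. If $Ric(\eta,\eta)\leq 0$, then $\eta$ is parallel.
   Context: Let $M$ be a smooth manifold with a Poisson tensor $\Pi$ (bivector field with $[\Pi,\Pi]_S=0$), and let $g$ be the cometric (induced metric on $T^*M$) of a Riemannian metric on $M$. The sharp map is defined by $\eta(\sharp_\Pi(\omega))=\Pi(\omega,\eta)$ and the Koszul bracket on 1-forms is $[\omega,\eta]_\Pi=\mathcal{L}_{\sharp_\Pi(\omega)}\eta-\mathcal{L}_{\sharp_\Pi(\eta)}\omega-d(\Pi(\omega,\eta))$. The contravariant Levi-Civita connection of $(\Pi,g)$ is the unique map $\mathcal{D}:\Omega^1(M)\times\Omega^1(M)\to\Omega^1(M)$, $\mathbb{R}$-bilinear with $\mathcal{D}_{\phi\omega}\eta=\phi\mathcal{D}_\omega\eta$ and $\mathcal{D}_\omega(\phi\eta)=\phi\mathcal{D}_\omega\eta+\sharp_\Pi(\omega)(\phi)\eta$ for $\phi\in\mathcal{C}^\infty(M)$, satisfying $\mathcal{D}_\omega\eta-\mathcal{D}_\eta\omega=[\omega,\eta]_\Pi$ and $\sharp_\Pi(\omega)g(\eta,\gamma)=g(\mathcal{D}_\omega\eta,\gamma)+g(\eta,\mathcal{D}_\omega\gamma)$. $(M,g,\Pi)$ is a Riemannian Poisson manifold if $\mathcal{D}\Pi=0$, i.e. $\sharp_\Pi(\omega)\Pi(\eta,\gamma)=\Pi(\mathcal{D}_\omega\eta,\gamma)+\Pi(\eta,\mathcal{D}_\omega\gamma)$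 for all 1-forms. Curvature: $\mathcal{R}(\omega,\eta)\gamma=\mathcal{D}_\omega\mathcal{D}_\eta\gamma-\mathcal{D}_\eta\mathcal{D}_\omega\gamma-\mathcal{D}_{[\omega,\eta]_\Pi}\gamma$. Ricci curvature: $Ric(\omega,\eta)=\sum_{i=1}^n g(\mathcal{R}(\omega,\theta_i)\theta_i,\eta)$ for any local orthonormal coframe $\{\theta_1,\dots,\theta_n\}$; $Ric(\eta,\eta)\le 0$ means at every point of $M$. For a 1-form $\eta$ and a $C^\infty(M)$-bilinear form $T$ on 1-forms, $(\mathcal{L}_\eta T)(\alpha,\beta)=\sharp_\Pi(\eta)(T(\alpha,\beta))-T([\eta,\alpha]_\Pi,\beta)-T(\alpha,[\eta,\beta]_\Pi)$. $\eta$ is a 2-Killing 1-form if $\mathcal{L}_\eta\mathcal{L}_\eta g=0$. $\eta$ is parallel if $\mathcal{D}\eta=0$, i.e. $\mathcal{D}_\alpha\eta=0$ for all $\alpha\in\Omega^1(M)$. *)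

theory Defs
  imports "HOL-Analysis.Analysis" "HOL-Library.Function_Algebras"
begin

text \<open>
  The points of the manifold form a whole type \<open>'a\<close>; its topology is the type-class topology, its
  smooth structure is given by an atlas, and its dimension is \<open>CARD('n)\<close>. Functions, vector fields
  and 1-forms are added, subtracted and multiplied pointwise, by the instances of
  \<open>Function_Algebras\<close>. Vector fields are maps on smooth functions and 1-forms are maps on vector
  fields; outside of these domains they take the value 0, so that equality of vector fields and of
  1-forms is HOL equality.
\<close>

type_synonym 'a sfun = "'a \<Rightarrow> real"
type_synonym 'a vfield = "'a sfun \<Rightarrow> 'a sfun"
type_synonym 'a form = "'a vfield \<Rightarrow> 'a sfun"
type_synonym 'a form_tensor = "'a form \<Rightarrow> 'a form \<Rightarrow> 'a sfun"
type_synonym 'a form_conn = "'a form \<Rightarrow> 'a form \<Rightarrow> 'a form"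
type_synonym ('a, 'n) atlas = "('a set \<times> ('a \<Rightarrow> real ^ 'n)) set"


section \<open>Smooth manifolds\<close>

text \<open>Only used on open sets \<open>S\<close>.\<close>

fun Ck_on :: "nat \<Rightarrow> 'b::real_normed_vector set \<Rightarrow> ('b \<Rightarrow> 'c::real_normed_vector) \<Rightarrow> bool" where
  "Ck_on 0 S f \<longleftrightarrow> continuous_on S f"
| "Ck_on (Suc k) S f \<longleftrightarrow>
     (\<forall>x\<in>S. f differentiable (at x)) \<and> (\<forall>v. Ck_on k S (\<lambda>x. frechet_derivative f (at x) v))"

definition smooth_on :: "'b::real_normed_vector set \<Rightarrow> ('b \<Rightarrow> 'c::real_normed_vector) \<Rightarrow> bool" where
  "smooth_on S f \<longleftrightarrow> (\<forall>k. Ck_on k S f)"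

definition smooth_atlas :: "('a::topological_space, 'n::finite) atlas \<Rightarrow> bool" where
  "smooth_atlas A \<longleftrightarrow>
     (\<Union>(U, \<phi>)\<in>A. U) = UNIV \<and>
     (\<forall>(U, \<phi>)\<in>A. open U \<and> open (\<phi> ` U) \<and> homeomorphism U (\<phi> ` U) \<phi> (inv_into U \<phi>)) \<and>
     (\<forall>(U, \<phi>)\<in>A. \<forall>(V, \<psi>)\<in>A. smooth_on (\<phi> ` (U \<inter> V)) (\<psi> \<circ> inv_into U \<phi>))"

definition smooth_funs :: "('a::topological_space, 'n::finite) atlas \<Rightarrow> 'a sfun set" where
  "smooth_funs A = {f. \<forall>(U, \<phi>)\<in>A. smooth_on (\<phi> ` U) (f \<circ> inv_into U \<phi>)}"


section \<open>Vector fields and 1-forms\<close>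

definition smult :: "'a sfun \<Rightarrow> ('b \<Rightarrow> 'a sfun) \<Rightarrow> 'b \<Rightarrow> 'a sfun" (infixr "\<cdot>\<^sub>s" 75) where
  "f \<cdot>\<^sub>s T = (\<lambda>x. f * T x)"

text \<open>Vector fields are the derivations of the algebra of smooth functions.\<close>

definition vector_fields :: "('a::topological_space, 'n::finite) atlas \<Rightarrow> 'a vfield set" where
  "vector_fields A = {X.
     (\<forall>f. f \<notin> smooth_funs A \<longrightarrow> X f = 0) \<and>
     (\<forall>f\<in>smooth_funs A. X f \<in> smooth_funs A) \<and>
     (\<forall>f\<in>smooth_funs A. \<forall>h\<in>smooth_funs A. X (f + h) = X f + X h) \<and>
     (\<forall>c. \<forall>f\<in>smooth_funs A. X ((\<lambda>_. c) * f) = (\<lambda>_. c) * X f) \<and>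
     (\<forall>f\<in>smooth_funs A. \<forall>h\<in>smooth_funs A. X (f * h) = f * X h + X f * h)}"

definition one_forms :: "('a::topological_space, 'n::finite) atlas \<Rightarrow> 'a form set" where
  "one_forms A = {\<omega>.
     (\<forall>X. X \<notin> vector_fields A \<longrightarrow> \<omega> X = 0) \<and>
     (\<forall>X\<in>vector_fields A. \<omega> X \<in> smooth_funs A) \<and>
     (\<forall>X\<in>vector_fields A. \<forall>Y\<in>vector_fields A. \<omega> (X + Y) = \<omega> X + \<omega> Y) \<and>
     (\<forall>f\<in>smooth_funs A. \<forall>X\<in>vector_fields A. \<omega> (f \<cdot>\<^sub>s X) = f * \<omega> X)}"

definition lie_bracket :: "'a vfield \<Rightarrow> 'a vfield \<Rightarrow> 'a vfield" where
  "lie_bracket X Y = (\<lambda>f. X (Y f) - Y (X f))"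

definition ext_d :: "('a::topological_space, 'n::finite) atlas \<Rightarrow> 'a sfun \<Rightarrow> 'a form" where
  "ext_d A f = (\<lambda>X. if X \<in> vector_fields A then X f else 0)"

definition lie_form ::
    "('a::topological_space, 'n::finite) atlas \<Rightarrow> 'a vfield \<Rightarrow> 'a form \<Rightarrow> 'a form" where
  "lie_form A X \<omega> =
     (\<lambda>Y. if Y \<in> vector_fields A then X (\<omega> Y) - \<omega> (lie_bracket X Y) else 0)"


section \<open>Bilinear tensors\<close>

text \<open>
  Smooth-function-bilinear forms on a module \<open>E\<close> (vector fields or 1-forms). A bivector field is
  a skew-symmetric bilinear form on 1-forms.
\<close>

definition sbilinear ::
    "('a::topological_space, 'n::finite) atlas \<Rightarrow> ('b \<Rightarrow> 'a sfun) set \<Rightarrow>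
     (('b \<Rightarrow> 'a sfun) \<Rightarrow> ('b \<Rightarrow> 'a sfun) \<Rightarrow> 'a sfun) \<Rightarrow> bool" where
  "sbilinear A E T \<longleftrightarrow>
     (\<forall>x\<in>E. \<forall>y\<in>E. T x y \<in> smooth_funs A) \<and>
     (\<forall>x\<in>E. \<forall>y\<in>E. \<forall>z\<in>E. T (x + y) z = T x z + T y z \<and> T z (x + y) = T z x + T z y) \<and>
     (\<forall>f\<in>smooth_funs A. \<forall>x\<in>E. \<forall>y\<in>E. T (f \<cdot>\<^sub>s x) y = f * T x y \<and> T x (f \<cdot>\<^sub>s y) = f * T x y)"

definition bivector_field ::
    "('a::topological_space, 'n::finite) atlas \<Rightarrow> 'a form_tensor \<Rightarrow> bool" where
  "bivector_field A P \<longleftrightarrow>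
     sbilinear A (one_forms A) P \<and>
     (\<forall>\<omega>\<in>one_forms A. \<forall>\<eta>\<in>one_forms A. P \<omega> \<eta> = - P \<eta> \<omega>)"

definition riemannian_metric ::
    "('a::topological_space, 'n::finite) atlas \<Rightarrow> ('a vfield \<Rightarrow> 'a vfield \<Rightarrow> 'a sfun) \<Rightarrow> bool" where
  "riemannian_metric A G \<longleftrightarrow>
     sbilinear A (vector_fields A) G \<and>
     (\<forall>X\<in>vector_fields A. \<forall>Y\<in>vector_fields A. G X Y = G Y X) \<and>
     (\<forall>X\<in>vector_fields A. \<forall>p. (\<exists>f\<in>smooth_funs A. X f p \<noteq> 0) \<longrightarrow> G X X p > 0)"

definition flat ::
    "('a::topological_space, 'n::finite) atlas \<Rightarrow> ('a vfield \<Rightarrow> 'a vfield \<Rightarrow> 'a sfun) \<Rightarrow>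
     'a vfield \<Rightarrow> 'a form" where
  "flat A G X = (\<lambda>Y. if Y \<in> vector_fields A then G X Y else 0)"

text \<open>The cometric is the metric transported to 1-forms by the musical isomorphism.\<close>

definition cometric_of ::
    "('a::topological_space, 'n::finite) atlas \<Rightarrow> ('a vfield \<Rightarrow> 'a vfield \<Rightarrow> 'a sfun) \<Rightarrow>
     'a form_tensor \<Rightarrow> bool" where
  "cometric_of A G g \<longleftrightarrow>
     sbilinear A (one_forms A) g \<and>
     (\<forall>X\<in>vector_fields A. \<forall>Y\<in>vector_fields A. g (flat A G X) (flat A G Y) = G X Y)"


section \<open>Poisson tensors\<close>

definition sharp ::
    "('a::topological_space, 'n::finite) atlas \<Rightarrow> 'a form_tensor \<Rightarrow> 'a form \<Rightarrow> 'a vfield" where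
  "sharp A P \<omega> = (THE X. X \<in> vector_fields A \<and> (\<forall>\<eta>\<in>one_forms A. \<eta> X = P \<omega> \<eta>))"

text \<open>
  The Schouten bracket of two bivector fields, by the formula of Gelfand and Dorfman: the
  cyclic sum of \<open>P (L\<^bsub>sharp Q \<alpha>\<^esub> \<beta>, \<gamma>) + Q (L\<^bsub>sharp P \<alpha>\<^esub> \<beta>, \<gamma>)\<close>. It is trilinear over the smooth
  functions and alternating. On coordinate differentials \<open>[P, P] (dx\<^sub>i, dx\<^sub>j, dx\<^sub>k)\<close> is
  twice the cyclic sum of \<open>\<Sum>l. P\<^sub>l\<^sub>k \<partial>\<^sub>l P\<^sub>i\<^sub>j\<close>, which is the usual
  Schouten bracket (conventions in the literature differ by a global sign).
\<close>

definition schouten ::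
    "('a::topological_space, 'n::finite) atlas \<Rightarrow> 'a form_tensor \<Rightarrow> 'a form_tensor \<Rightarrow>
     'a form \<Rightarrow> 'a form \<Rightarrow> 'a form \<Rightarrow> 'a sfun" where
  "schouten A P Q \<alpha> \<beta> \<gamma> =
     P (lie_form A (sharp A Q \<alpha>) \<beta>) \<gamma> + Q (lie_form A (sharp A P \<alpha>) \<beta>) \<gamma> +
     P (lie_form A (sharp A Q \<beta>) \<gamma>) \<alpha> + Q (lie_form A (sharp A P \<beta>) \<gamma>) \<alpha> +
     P (lie_form A (sharp A Q \<gamma>) \<alpha>) \<beta> + Q (lie_form A (sharp A P \<gamma>) \<alpha>) \<beta>"

definition poisson_tensor ::
    "('a::topological_space, 'n::finite) atlas \<Rightarrow> 'a form_tensor \<Rightarrow> bool" where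
  "poisson_tensor A P \<longleftrightarrow>
     bivector_field A P \<and>
     (\<forall>\<alpha>\<in>one_forms A. \<forall>\<beta>\<in>one_forms A. \<forall>\<gamma>\<in>one_forms A. schouten A P P \<alpha> \<beta> \<gamma> = 0)"

definition koszul ::
    "('a::topological_space, 'n::finite) atlas \<Rightarrow> 'a form_tensor \<Rightarrow> 'a form \<Rightarrow> 'a form \<Rightarrow> 'a form" where
  "koszul A P \<omega> \<eta> =
     lie_form A (sharp A P \<omega>) \<eta> - lie_form A (sharp A P \<eta>) \<omega> - ext_d A (P \<omega> \<eta>)"


section \<open>The contravariant Levi-Civita connection\<close>

definition contravariant_connection ::
    "('a::topological_space, 'n::finite) atlas \<Rightarrow> 'a form_tensor \<Rightarrow> 'a form_conn \<Rightarrow> bool" where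
  "contravariant_connection A P D \<longleftrightarrow>
     (\<forall>\<omega>\<in>one_forms A. \<forall>\<eta>\<in>one_forms A. D \<omega> \<eta> \<in> one_forms A) \<and>
     (\<forall>\<omega>\<in>one_forms A. \<forall>\<eta>\<in>one_forms A. \<forall>\<gamma>\<in>one_forms A.
        D (\<omega> + \<eta>) \<gamma> = D \<omega> \<gamma> + D \<eta> \<gamma> \<and> D \<gamma> (\<omega> + \<eta>) = D \<gamma> \<omega> + D \<gamma> \<eta>) \<and>
     (\<forall>c. \<forall>\<omega>\<in>one_forms A. \<forall>\<eta>\<in>one_forms A.
        D ((\<lambda>_. c) \<cdot>\<^sub>s \<omega>) \<eta> = (\<lambda>_. c) \<cdot>\<^sub>s D \<omega> \<eta> \<and> D \<omega> ((\<lambda>_. c) \<cdot>\<^sub>s \<eta>) = (\<lambda>_. c) \<cdot>\<^sub>s D \<omega> \<eta>) \<and>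
     (\<forall>f\<in>smooth_funs A. \<forall>\<omega>\<in>one_forms A. \<forall>\<eta>\<in>one_forms A.
        D (f \<cdot>\<^sub>s \<omega>) \<eta> = f \<cdot>\<^sub>s D \<omega> \<eta> \<and>
        D \<omega> (f \<cdot>\<^sub>s \<eta>) = f \<cdot>\<^sub>s D \<omega> \<eta> + sharp A P \<omega> f \<cdot>\<^sub>s \<eta>)"

definition contravariant_levi_civita ::
    "('a::topological_space, 'n::finite) atlas \<Rightarrow> 'a form_tensor \<Rightarrow> 'a form_tensor \<Rightarrow>
     'a form_conn \<Rightarrow> bool" where
  "contravariant_levi_civita A P g D \<longleftrightarrow>
     contravariant_connection A P D \<and>
     (\<forall>\<omega>\<in>one_forms A. \<forall>\<eta>\<in>one_forms A. D \<omega> \<eta> - D \<eta> \<omega> = koszul A P \<omega> \<eta>) \<and>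
     (\<forall>\<omega>\<in>one_forms A. \<forall>\<eta>\<in>one_forms A. \<forall>\<gamma>\<in>one_forms A.
        sharp A P \<omega> (g \<eta> \<gamma>) = g (D \<omega> \<eta>) \<gamma> + g \<eta> (D \<omega> \<gamma>))"

definition riemannian_poisson ::
    "('a::topological_space, 'n::finite) atlas \<Rightarrow> ('a vfield \<Rightarrow> 'a vfield \<Rightarrow> 'a sfun) \<Rightarrow>
     'a form_tensor \<Rightarrow> 'a form_tensor \<Rightarrow> 'a form_conn \<Rightarrow> bool" where
  "riemannian_poisson A G g P D \<longleftrightarrow>
     riemannian_metric A G \<and> cometric_of A G g \<and> poisson_tensor A P \<and>
     contravariant_levi_civita A P g D \<and>
     (\<forall>\<omega>\<in>one_forms A. \<forall>\<eta>\<in>one_forms A. \<forall>\<gamma>\<in>one_forms A.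
        sharp A P \<omega> (P \<eta> \<gamma>) = P (D \<omega> \<eta>) \<gamma> + P \<eta> (D \<omega> \<gamma>))"

definition parallel_form ::
    "('a::topological_space, 'n::finite) atlas \<Rightarrow> 'a form_conn \<Rightarrow> 'a form \<Rightarrow> bool" where
  "parallel_form A D \<eta> \<longleftrightarrow> (\<forall>\<alpha>\<in>one_forms A. D \<alpha> \<eta> = 0)"


section \<open>Curvature\<close>

definition curvature ::
    "('a::topological_space, 'n::finite) atlas \<Rightarrow> 'a form_tensor \<Rightarrow> 'a form_conn \<Rightarrow>
     'a form \<Rightarrow> 'a form \<Rightarrow> 'a form \<Rightarrow> 'a form" where
  "curvature A P D \<omega> \<eta> \<gamma> = D \<omega> (D \<eta> \<gamma>) - D \<eta> (D \<omega> \<gamma>) - D (koszul A P \<omega> \<eta>) \<gamma>"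

text \<open>
  A local orthonormal coframe around \<open>p\<close> is given by global 1-forms that are orthonormal
  near \<open>p\<close>: multiplied by a bump function, any coframe on an open set containing \<open>p\<close> extends to
  such a family without being changed near \<open>p\<close>.
\<close>

definition local_orthonormal_coframe ::
    "('a::topological_space, 'n::finite) atlas \<Rightarrow> 'a form_tensor \<Rightarrow> 'a \<Rightarrow> ('n \<Rightarrow> 'a form) \<Rightarrow> bool" where
  "local_orthonormal_coframe A g p \<theta> \<longleftrightarrow>
     (\<forall>i. \<theta> i \<in> one_forms A) \<and>
     (\<exists>U. open U \<and> p \<in> U \<and> (\<forall>q\<in>U. \<forall>i j. g (\<theta> i) (\<theta> j) q = (if i = j then 1 else 0)))"

text \<open>
  The curvature is a tensor, so the value of the sum at \<open>p\<close> is the same for every local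
  orthonormal coframe \<open>\<theta>\<close> around \<open>p\<close>; the choice operator only picks one of them.
\<close>

definition ricci ::
    "('a::topological_space, 'n::finite) atlas \<Rightarrow> 'a form_tensor \<Rightarrow> 'a form_tensor \<Rightarrow>
     'a form_conn \<Rightarrow> 'a form_tensor" where
  "ricci A P g D \<omega> \<eta> p =
     (let \<theta> = (SOME \<theta>. local_orthonormal_coframe A g p \<theta>)
      in \<Sum>i\<in>UNIV. g (curvature A P D \<omega> (\<theta> i) (\<theta> i)) \<eta> p)"


section \<open>2-Killing 1-forms\<close>

definition lie_tensor ::
    "('a::topological_space, 'n::finite) atlas \<Rightarrow> 'a form_tensor \<Rightarrow> 'a form \<Rightarrow>
     'a form_tensor \<Rightarrow> 'a form_tensor" where
  "lie_tensor A P \<eta> T \<alpha> \<beta> =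
     sharp A P \<eta> (T \<alpha> \<beta>) - T (koszul A P \<eta> \<alpha>) \<beta> - T \<alpha> (koszul A P \<eta> \<beta>)"

definition two_killing ::
    "('a::topological_space, 'n::finite) atlas \<Rightarrow> 'a form_tensor \<Rightarrow> 'a form_tensor \<Rightarrow>
     'a form \<Rightarrow> bool" where
  "two_killing A P g \<eta> \<longleftrightarrow>
     \<eta> \<in> one_forms A \<and>
     (\<forall>\<alpha>\<in>one_forms A. \<forall>\<beta>\<in>one_forms A.
        lie_tensor A P \<eta> (lie_tensor A P \<eta> g) \<alpha> \<beta> = 0)"

end

theory Submission
  imports Defs "HOL-Real_Asymp.Real_Asymp"
begin

text \<open>
  The theorem rests on a pointwise identity. Since \<open>D\<close> is metric and free of torsion, the Lie derivative
  of the cometric along \<open>\<eta>\<close> is \<open>(\<alpha>, \<beta>) \<mapsto> g (D \<alpha> \<eta>) \<beta> + g \<alpha> (D \<beta> \<eta>)\<close> (\<open>lie_cometric\<close>). Deriving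
  once more and evaluating at \<open>(\<alpha>, \<alpha>)\<close>, the 2-Killing equation together with \<open>D \<eta> \<eta> = 0\<close> becomes
  \<open>g (R (\<eta>, \<alpha>) \<alpha>, \<eta>) = g (D \<alpha> \<eta>, D \<alpha> \<eta>)\<close> (\<open>two_killing_curvature\<close>). The sum over an orthonormal coframe
  says that \<open>Ric (\<eta>, \<eta>)\<close> is the square norm of the tensor \<open>\<alpha> \<mapsto> D \<alpha> \<eta>\<close>. If it is nonpositive, this
  tensor vanishes, which is what parallel means.

  The identity is formal, except that second derivatives of a function must cancel; this needs the sharp map
  to carry the Koszul bracket to the Lie bracket (\<open>sharp_koszul\<close>), a consequence of the Jacobi
  identity for the Poisson tensor.

  The remaining work links the algebraic definitions to points. Vector fields are derivations
  and forms are functionals on them, so it must be shown that the value at a point of an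
  expression linear over the functions depends on \<open>CARD('n)\<close> components only. Bump functions and
  Hadamard's lemma (\<open>hadamard\<close>) yield the expansion of a derivation in coordinate fields
  (\<open>coord_expansion\<close>) and, dually, of a form in coordinate differentials
  (\<open>tensorial_pointwise_expansion\<close>). From these expansions follow the existence of the sharp map, the existence of local
  orthonormal coframes, the fact that they span, and the symmetry and definiteness of the cometric,
  which is given only on the forms that come from vector fields.
\<close>

section \<open>Calculus of differentiable functions of a given order\<close>

lemma Ck_on_cong:
  assumes "Ck_on k S f" "open S" "\<And>x. x \<in> S \<Longrightarrow> f x = h x"
  shows "Ck_on k S h"
  using assms
proof (induction k arbitrary: f h)
  case 0
  then show ?case using continuous_on_eq by auto
next
  case (Suc k)
  have d: "(h has_derivative frechet_derivative f (at x)) (at x)" if "x \<in> S" for x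
  proof -
    have "(f has_derivative frechet_derivative f (at x)) (at x)"
      using Suc.prems(1) that by (simp flip: frechet_derivative_works)
    then show ?thesis
      using has_derivative_transform_within_open[of f _ x UNIV S h] Suc.prems(2,3) that by auto
  qed
  have e: "frechet_derivative f (at x) = frechet_derivative h (at x)" if "x \<in> S" for x
    using d[OF that] frechet_derivative_at by blast
  have "Ck_on k S (\<lambda>x. frechet_derivative h (at x) v)" for v
    using Suc.IH[of "\<lambda>x. frechet_derivative f (at x) v"] Suc.prems e by auto
  then show ?case using d by (auto simp: differentiable_def)
qed

text \<open>
  The recursion of \<open>Ck_on\<close> asks for continuity only at level 0, so monotonicity in the degree needs
  an induction.
\<close>

lemma Ck_on_Suc_D: "Ck_on (Suc k) S f \<Longrightarrow> Ck_on k S f"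
proof (induction k arbitrary: f)
  case 0
  then show ?case
    by (metis Ck_on.simps differentiable_at_imp_differentiable_on differentiable_imp_continuous_on)
next
  case (Suc k)
  then show ?case by (metis Ck_on.simps(2))
qed

text \<open>
  \<open>Ck_on\<close> speaks of \<open>frechet_derivative\<close>; with any derivative exhibited by a
  differentiation rule in its place, the closure properties below reduce to these rules.
\<close>

lemma Ck_on_SucI:
  assumes "open S"
    and "\<And>x. x \<in> S \<Longrightarrow> (f has_derivative f' x) (at x)"
    and "\<And>v. Ck_on k S (\<lambda>x. f' x v)"
  shows "Ck_on (Suc k) S f"
proof -
  have "Ck_on k S (\<lambda>x. frechet_derivative f (at x) v)" for v
    by (rule Ck_on_cong[OF assms(3)[of v] assms(1)]) (simp flip: frechet_derivative_at[OF assms(2)])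
  then show ?thesis using assms(2) by (auto simp: differentiable_def)
qed

lemma Ck_on_SucD:
  assumes "Ck_on (Suc k) S f"
  shows "x \<in> S \<Longrightarrow> (f has_derivative frechet_derivative f (at x)) (at x)"
    and "Ck_on k S (\<lambda>x. frechet_derivative f (at x) v)"
  using assms frechet_derivative_works[of f "at x"] by simp_all

lemma Ck_on_imp_continuous_on: "Ck_on k S f \<Longrightarrow> continuous_on S f"
proof (induction k)
  case (Suc k)
  then show ?case using Ck_on_Suc_D by blast
qed simp

lemma Ck_on_subset: "Ck_on k S f \<Longrightarrow> T \<subseteq> S \<Longrightarrow> Ck_on k T f"
  by (induction k arbitrary: f) (auto intro: continuous_on_subset)

lemma Ck_on_Un:
  "open S \<Longrightarrow> open T \<Longrightarrow> Ck_on k S f \<Longrightarrow> Ck_on k T f \<Longrightarrow> Ck_on k (S \<union> T) f"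
  by (induction k arbitrary: f) (auto intro: continuous_on_open_Un)

lemma Ck_on_const: "Ck_on k S (\<lambda>x. c)"
proof (induction k arbitrary: c)
  case (Suc k)
  have "frechet_derivative (\<lambda>x. c) (at x) = (\<lambda>_. 0)" for x
    by (rule frechet_derivative_at[symmetric]) simp
  with Suc show ?case by simp
qed simp

lemma Ck_on_linear:
  assumes "bounded_linear f" shows "Ck_on k S f"
proof (cases k)
  case 0
  then show ?thesis using assms linear_continuous_on by auto
next
  case (Suc j)
  have "(f has_derivative f) (at x)" for x
    using assms bounded_linear_imp_has_derivative by blast
  moreover from this have "frechet_derivative f (at x) = f" for x
    using frechet_derivative_at by metis
  ultimately show ?thesis using Suc Ck_on_const by (auto simp: differentiable_def)
qed

lemma Ck_on_linear_comp:
  assumes "bounded_linear L" "open S" "Ck_on k S f" shows "Ck_on k S (\<lambda>x. L (f x))"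
  using assms(3)
proof (induction k arbitrary: f)
  case 0
  then show ?case using assms(1) by (auto intro: bounded_linear.continuous_on)
next
  case (Suc k)
  show ?case
    by (rule Ck_on_SucI[OF assms(2) bounded_linear.has_derivative[OF assms(1)
          Ck_on_SucD(1)[OF Suc.prems]] Suc.IH[OF Ck_on_SucD(2)[OF Suc.prems]]])
qed

lemma Ck_on_add:
  assumes "open S" "Ck_on k S f" "Ck_on k S h" shows "Ck_on k S (\<lambda>x. f x + h x)"
  using assms(2,3)
proof (induction k arbitrary: f h)
  case 0
  then show ?case by (auto intro: continuous_intros)
next
  case (Suc k)
  show ?case
    by (rule Ck_on_SucI[OF assms(1) has_derivative_add[OF Ck_on_SucD(1)[OF Suc.prems(1)]
          Ck_on_SucD(1)[OF Suc.prems(2)]] Suc.IH[OF Ck_on_SucD(2)[OF Suc.prems(1)]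
          Ck_on_SucD(2)[OF Suc.prems(2)]]])
qed

lemma Ck_on_sum:
  assumes "open S" "\<And>i. i \<in> I \<Longrightarrow> Ck_on k S (f i)" shows "Ck_on k S (\<lambda>x. \<Sum>i\<in>I. f i x)"
  using assms(2)
  by (induction I rule: infinite_finite_induct) (auto intro: Ck_on_add[OF assms(1)] Ck_on_const)

text \<open>
  Differentiating the product leaves products of the same shape with one factor replaced by
  its directional derivative, so the induction hypothesis applies to both summands.
\<close>

lemma Ck_on_bilinear:
  assumes "bounded_bilinear B" "open S" "Ck_on k S f" "Ck_on k S h"
  shows "Ck_on k S (\<lambda>x. B (f x) (h x))"
  using assms(3,4)
proof (induction k arbitrary: f h)
  case 0
  then show ?case using bounded_bilinear.continuous_on[OF assms(1)] by auto
next
  case (Suc k)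
  show ?case
    by (rule Ck_on_SucI[OF assms(2) bounded_bilinear.FDERIV[OF assms(1)
          Ck_on_SucD(1)[OF Suc.prems(1)] Ck_on_SucD(1)[OF Suc.prems(2)]]])
      (auto intro!: Ck_on_add[OF assms(2)] Suc.IH Ck_on_Suc_D[OF Suc.prems(1)]
        Ck_on_Suc_D[OF Suc.prems(2)] Ck_on_SucD(2)[OF Suc.prems(1)] Ck_on_SucD(2)[OF Suc.prems(2)])
qed

text \<open>
  The chain rule expresses the derivative of a composition in a fixed direction only after
  the inner derivative is expanded in a basis: this turns it into a sum of products of
  components of \<open>Du\<close> with compositions of partial derivatives of \<open>f\<close>.
\<close>

lemma Ck_on_comp:
  fixes u :: "'b::real_normed_vector \<Rightarrow> 'c::euclidean_space" and f :: "'c \<Rightarrow> 'd::real_normed_vector"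
  assumes "open S" "open T" "u ` S \<subseteq> T" "Ck_on k S u" "Ck_on k T f"
  shows "Ck_on k S (\<lambda>x. f (u x))"
  using assms(4,5)
proof (induction k arbitrary: f)
  case 0
  then show ?case using assms(3) by (auto intro: continuous_on_compose2)
next
  case (Suc k)
  let ?Du = "\<lambda>x. frechet_derivative u (at x)" and ?Df = "\<lambda>x. frechet_derivative f (at x)"
  note u = Ck_on_SucD[OF Suc.prems(1)] and f = Ck_on_SucD[OF Suc.prems(2)]
  have "((\<lambda>x. f (u x)) has_derivative (\<lambda>v. \<Sum>b\<in>Basis. (?Du x v \<bullet> b) *\<^sub>R ?Df (u x) b)) (at x)"
    if "x \<in> S" for x
  proof -
    have D: "(f has_derivative ?Df (u x)) (at (u x))" using f(1) assms(3) that by auto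
    then have lin: "linear (?Df (u x))" using has_derivative_linear by blast
    have "?Df (u x) w = (\<Sum>b\<in>Basis. (w \<bullet> b) *\<^sub>R ?Df (u x) b)" for w
    proof -
      have "?Df (u x) w = ?Df (u x) (\<Sum>b\<in>Basis. (w \<bullet> b) *\<^sub>R b)"
        by (simp only: euclidean_representation)
      also have "\<dots> = (\<Sum>b\<in>Basis. (w \<bullet> b) *\<^sub>R ?Df (u x) b)"
        by (simp only: linear_sum[OF lin] linear_scale[OF lin])
      finally show ?thesis .
    qed
    then have "?Df (u x) \<circ> ?Du x = (\<lambda>v. \<Sum>b\<in>Basis. (?Du x v \<bullet> b) *\<^sub>R ?Df (u x) b)"
      unfolding o_def by (intro ext)
    with diff_chain_at[OF u(1)[OF that] D] show ?thesis by (simp only: o_def[of f u])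
  qed
  then show ?case
  proof (rule Ck_on_SucI[OF assms(1)])
    show "Ck_on k S (\<lambda>x. \<Sum>b\<in>Basis. (?Du x v \<bullet> b) *\<^sub>R ?Df (u x) b)" for v
      by (intro Ck_on_sum[OF assms(1)] Ck_on_bilinear[OF bounded_bilinear_scaleR assms(1)]
          Ck_on_linear_comp[OF bounded_linear_inner_left assms(1)] u(2) Suc.IH[OF _ f(2)]
          Ck_on_Suc_D[OF Suc.prems(1)]) 
  qed
qed

lemma smooth_on_cong:
  "smooth_on S f \<Longrightarrow> open S \<Longrightarrow> (\<And>x. x \<in> S \<Longrightarrow> f x = h x) \<Longrightarrow> smooth_on S h"
  unfolding smooth_on_def using Ck_on_cong by blast

lemma smooth_on_const: "smooth_on S (\<lambda>x. c)"
  by (simp add: smooth_on_def Ck_on_const)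

lemma smooth_on_linear: "bounded_linear f \<Longrightarrow> smooth_on S f"
  by (simp add: smooth_on_def Ck_on_linear)

lemma smooth_on_add:
  "open S \<Longrightarrow> smooth_on S f \<Longrightarrow> smooth_on S h \<Longrightarrow> smooth_on S (\<lambda>x. f x + h x)"
  by (simp add: smooth_on_def Ck_on_add)

lemma smooth_on_bilinear:
  "bounded_bilinear B \<Longrightarrow> open S \<Longrightarrow> smooth_on S f \<Longrightarrow> smooth_on S h \<Longrightarrow>
    smooth_on S (\<lambda>x. B (f x) (h x))"
  by (simp add: smooth_on_def Ck_on_bilinear)

lemmas smooth_on_mult =
  smooth_on_bilinear[OF bounded_bilinear_mult[where 'a=real]]

lemma smooth_on_minus:
  assumes "open S" "smooth_on S f" "smooth_on S h" shows "smooth_on S (\<lambda>x. f x - h x :: real)"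
  using smooth_on_add[OF assms(1,2) smooth_on_mult[OF assms(1) smooth_on_const[of S "-1"] assms(3)]]
  by simp

lemma smooth_on_comp:
  fixes u :: "'b::real_normed_vector \<Rightarrow> 'c::euclidean_space"
  shows "open S \<Longrightarrow> open T \<Longrightarrow> u ` S \<subseteq> T \<Longrightarrow> smooth_on S u \<Longrightarrow> smooth_on T f \<Longrightarrow>
    smooth_on S (\<lambda>x. f (u x))"
  unfolding smooth_on_def using Ck_on_comp by blast

lemma smooth_on_Un:
  "open S \<Longrightarrow> open T \<Longrightarrow> smooth_on S f \<Longrightarrow> smooth_on T f \<Longrightarrow> smooth_on (S \<union> T) f"
  by (simp add: smooth_on_def Ck_on_Un)

lemma smooth_on_subset: "smooth_on S f \<Longrightarrow> T \<subseteq> S \<Longrightarrow> smooth_on T f"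
  unfolding smooth_on_def using Ck_on_subset by blast

lemma smooth_on_imp_continuous_on: "smooth_on S f \<Longrightarrow> continuous_on S f"
  unfolding smooth_on_def using Ck_on_imp_continuous_on by blast

lemma smooth_on_has_derivative:
  "smooth_on S f \<Longrightarrow> x \<in> S \<Longrightarrow> (f has_derivative frechet_derivative f (at x)) (at x)"
  unfolding smooth_on_def using Ck_on_SucD(1) by blast

lemma smooth_on_frechet_derivative:
  "smooth_on S f \<Longrightarrow> smooth_on S (\<lambda>x. frechet_derivative f (at x) v)"
  unfolding smooth_on_def using Ck_on_SucD(2) by blast

lemma Ck_on_real_SucI:
  fixes f :: "real \<Rightarrow> real"
  assumes "open S" "\<And>x. x \<in> S \<Longrightarrow> (f has_real_derivative f' x) (at x)" "Ck_on k S f'"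
  shows "Ck_on (Suc k) S f"
proof (rule Ck_on_SucI[OF assms(1)])
  show "(f has_derivative (\<lambda>v. f' x * v)) (at x)" if "x \<in> S" for x
    using assms(2)[OF that] by (simp add: has_field_derivative_def)
  show "Ck_on k S (\<lambda>x. f' x * v)" for v
    by (rule Ck_on_bilinear[OF bounded_bilinear_mult assms(1,3) Ck_on_const])
qed

text \<open>
  Reciprocals and inverse square roots are the powers that occur below. All real exponents
  are treated at once because differentiation shifts the exponent.
\<close>

lemma smooth_on_powr: "smooth_on {0<..} (\<lambda>t::real. t powr a)"
proof -
  have "Ck_on k {0<..} (\<lambda>t::real. t powr a)" for k
  proof (induction k arbitrary: a)
    case 0
    then show ?case by (auto intro!: continuous_intros)
  next
    case (Suc k)
    show ?case
    proof (rule Ck_on_real_SucI)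
      show "((\<lambda>t. t powr a) has_real_derivative a * x powr (a - 1)) (at x)" if "x \<in> {0<..}" for x
        using that has_real_derivative_powr[of x a] by auto
      show "Ck_on k {0<..} (\<lambda>x. a * x powr (a - 1))"
        by (rule Ck_on_bilinear[OF bounded_bilinear_mult _ Ck_on_const Suc]) simp
    qed simp
  qed
  then show ?thesis by (simp add: smooth_on_def)
qed

section \<open>Smooth cutoff functions\<close>

text \<open>
  The functions \<open>exp (- 1 / t) / t ^ m\<close>, extended by 0. For \<open>m = 0\<close> this is the classical smooth
  function that is not analytic at 0; the whole family is closed under differentiation up to
  linear combinations, which makes its smoothness an induction.
\<close>

definition flat_exp :: "nat \<Rightarrow> real \<Rightarrow> real" where
  "flat_exp m t = (if t > 0 then exp (- 1 / t) / t ^ m else 0)"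

lemma flat_exp_deriv:
  "(flat_exp m has_real_derivative flat_exp (m + 2) t - real m * flat_exp (m + 1) t) (at t)"
proof -
  consider "t < 0" | "t = 0" | "t > 0" by linarith
  then show ?thesis
  proof cases
    case 1
    have "((\<lambda>_. 0) has_real_derivative 0) (at t)" by simp
    then have "(flat_exp m has_real_derivative 0) (at t)"
      by (rule has_field_derivative_transform_within_open[where S = "{..<0}"])
        (use 1 in \<open>auto simp: flat_exp_def\<close>)
    then show ?thesis using 1 by (simp add: flat_exp_def)
  next
    case 3
    have "((\<lambda>t. exp (- 1 / t)) has_real_derivative exp (- 1 / t) / (t * t)) (at t)"
      using 3 by (auto intro!: derivative_eq_intros simp: field_simps)
    from DERIV_divide[OF this DERIV_pow[of m t]] 3
    have "((\<lambda>t. exp (- 1 / t) / t ^ m) has_real_derivative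
        (exp (- 1 / t) / (t * t) * t ^ m - exp (- 1 / t) * (real m * t ^ (m - Suc 0))) / (t ^ m * t ^ m))
        (at t)" by simp
    also have "(exp (- 1 / t) / (t * t) * t ^ m - exp (- 1 / t) * (real m * t ^ (m - Suc 0))) / (t ^ m * t ^ m)
        = flat_exp (m + 2) t - real m * flat_exp (m + 1) t"
      using 3 by (cases m) (simp_all add: flat_exp_def field_simps)
    finally have "((\<lambda>t. exp (- 1 / t) / t ^ m) has_real_derivative
        flat_exp (m + 2) t - real m * flat_exp (m + 1) t) (at t)" .
    then show ?thesis
      by (rule has_field_derivative_transform_within_open[where S = "{0<..}"])
        (use 3 in \<open>auto simp: flat_exp_def\<close>)
  next
    case 2
    have "((\<lambda>h. (flat_exp m (0 + h) - flat_exp m 0) / h) \<longlongrightarrow> 0) (at_left 0)"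
      by (rule Lim_transform_eventually[of "\<lambda>_. 0"])
        (auto simp: flat_exp_def eventually_at_left_field intro: exI[of _ "-1"])
    moreover have "((\<lambda>h. exp (- 1 / h) / h ^ m / h) \<longlongrightarrow> 0) (at_right (0::real))"
      by real_asymp
    then have "((\<lambda>h. (flat_exp m (0 + h) - flat_exp m 0) / h) \<longlongrightarrow> 0) (at_right 0)"
      by (rule Lim_transform_eventually)
        (auto simp: flat_exp_def eventually_at_right_field intro: exI[of _ "1"])
    ultimately have "(flat_exp m has_real_derivative 0) (at 0)"
      by (simp add: DERIV_def filterlim_split_at)
    then show ?thesis using 2 by (simp add: flat_exp_def)
  qed
qed

lemma smooth_on_flat_exp: "smooth_on UNIV (flat_exp m)"
proof -
  have "Ck_on k UNIV (flat_exp m)" for k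
  proof (induction k arbitrary: m)
    case 0
    then show ?case
      using flat_exp_deriv[of m] by (auto intro!: DERIV_continuous_on)
  next
    case (Suc k)
    have "Ck_on k UNIV (\<lambda>t. flat_exp (m + 2) t + (- real m) * flat_exp (m + 1) t)"
      by (intro Ck_on_add Ck_on_bilinear[OF bounded_bilinear_mult] Ck_on_const Suc open_UNIV)
    then show ?case
      by (intro Ck_on_real_SucI[OF open_UNIV flat_exp_deriv]) simp
  qed
  then show ?thesis by (simp add: smooth_on_def)
qed

text \<open>
  A smooth step going down from 1 to 0 over the interval from 1 to 2.
\<close>

definition cutoff :: "real \<Rightarrow> real" where
  "cutoff t = flat_exp 0 (2 - t) / (flat_exp 0 (2 - t) + flat_exp 0 (t - 1))"

lemma flat_exp_pos: "t > 0 \<Longrightarrow> flat_exp m t > 0" and flat_exp_zero: "t \<le> 0 \<Longrightarrow> flat_exp m t = 0"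
  and flat_exp_nonneg: "flat_exp m t \<ge> 0"
  by (auto simp: flat_exp_def)

lemma cutoff_one: "t \<le> 1 \<Longrightarrow> cutoff t = 1" and cutoff_zero: "t \<ge> 2 \<Longrightarrow> cutoff t = 0"
  using flat_exp_pos[of "2 - t" 0] by (auto simp: cutoff_def flat_exp_zero)

lemma cutoff_bounds: "0 \<le> cutoff t" "cutoff t \<le> 1"
  using flat_exp_nonneg[of 0 "2 - t"] flat_exp_nonneg[of 0 "t - 1"]
  by (auto simp: cutoff_def divide_simps)

lemma smooth_on_cutoff: "smooth_on UNIV cutoff"
proof -
  have id: "smooth_on UNIV (\<lambda>t::real. t)" by (rule smooth_on_linear) (rule bounded_linear_ident)
  have a: "smooth_on UNIV (\<lambda>t. flat_exp 0 (2 - t))"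
    by (rule smooth_on_comp[OF open_UNIV open_UNIV _ _ smooth_on_flat_exp])
      (auto intro!: smooth_on_minus smooth_on_const id)
  have b: "smooth_on UNIV (\<lambda>t. flat_exp 0 (t - 1))"
    by (rule smooth_on_comp[OF open_UNIV open_UNIV _ _ smooth_on_flat_exp])
      (auto intro!: smooth_on_minus smooth_on_const id)
  have pos: "flat_exp 0 (2 - t) + flat_exp 0 (t - 1) > 0" for t
    using flat_exp_pos[of "2 - t" 0] flat_exp_pos[of "t - 1" 0]
      flat_exp_nonneg[of 0 "2 - t"] flat_exp_nonneg[of 0 "t - 1"] by fastforce
  have "smooth_on UNIV (\<lambda>t. flat_exp 0 (2 - t) * (flat_exp 0 (2 - t) + flat_exp 0 (t - 1)) powr (-1))"
    by (intro smooth_on_mult open_UNIV a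
        smooth_on_comp[OF open_UNIV _ _ smooth_on_add[OF open_UNIV a b] smooth_on_powr[of "-1"]])
      (auto simp: pos)
  moreover have "cutoff t = flat_exp 0 (2 - t) * (flat_exp 0 (2 - t) + flat_exp 0 (t - 1)) powr (-1)" for t
    using pos[of t] by (simp add: cutoff_def powr_minus divide_simps)
  ultimately show ?thesis by (auto intro: smooth_on_cong)
qed

section \<open>Hadamard's lemma\<close>

text \<open>
  Differentiation under the integral sign. Smoothness of the integrand is assumed jointly in
  both variables, because the induction needs continuity of all derivatives on the product.
\<close>

lemma Ck_on_integral_param:
  fixes \<Phi> :: "'b::euclidean_space \<times> real \<Rightarrow> real"
  assumes "Ck_on k UNIV \<Phi>"
  shows "Ck_on k UNIV (\<lambda>x. integral {0..1} (\<lambda>t. \<Phi> (x, t)))"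
  using assms
proof (induction k arbitrary: \<Phi>)
  case 0
  then have "continuous_on (UNIV \<times> cbox 0 1) (\<lambda>(x, t). \<Phi> (x, t))"
    by (auto intro: continuous_on_subset)
  then show ?case using integral_continuous_on_param[of UNIV 0 1 "\<lambda>x t. \<Phi> (x, t)"] by simp
next
  case (Suc k)
  let ?D = "\<lambda>z. frechet_derivative \<Phi> (at z)"
  define L where "L x t = Blinfun (\<lambda>v. ?D (x, t) (v, 0))" for x :: 'b and t :: real
  note \<Phi> = Ck_on_SucD[OF Suc.prems]
  have bl: "bounded_linear (\<lambda>v. ?D (x, t) (v, 0))" for x t
    using bounded_linear_compose[OF has_derivative_bounded_linear[OF \<Phi>(1)], of "(x, t)" "\<lambda>v. (v, 0)"]
    by (simp add: bounded_linear_Pair bounded_linear_ident bounded_linear_zero)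
  have L: "blinfun_apply (L x t) = (\<lambda>v. ?D (x, t) (v, 0))" for x t
    by (simp add: L_def bounded_linear_Blinfun_apply[OF bl])
  have cont: "continuous_on UNIV \<Phi>" using Suc.prems Ck_on_imp_continuous_on by blast
  \<comment> \<open>the Leibniz rule wants the partial derivative as a continuous map into bounded linear functions\<close>
  have contL: "continuous_on (UNIV \<times> cbox 0 1) (\<lambda>(x, t). L x t)"
    by (rule continuous_on_blinfun_componentwise)
      (auto simp: L case_prod_beta intro: continuous_on_subset[OF Ck_on_imp_continuous_on[OF \<Phi>(2)]])
  have "((\<lambda>x. integral {0..1} (\<lambda>t. \<Phi> (x, t))) has_derivative
      blinfun_apply (integral {0..1} (L x))) (at x)" for x
  proof -
    have "((\<lambda>x. integral (cbox 0 1) (\<lambda>t. \<Phi> (x, t))) has_derivative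
      blinfun_apply (integral (cbox 0 1) (L x))) (at x within UNIV)"
    proof (rule leibniz_rule)
      show "((\<lambda>x. \<Phi> (x, t)) has_derivative blinfun_apply (L x t)) (at x within UNIV)" for x t
        unfolding L
        by (rule has_derivative_compose[of "\<lambda>x. (x, t)" "\<lambda>v. (v, 0)" x UNIV \<Phi> "?D (x, t)"])
          (auto intro!: derivative_eq_intros \<Phi>(1))
      show "(\<lambda>t. \<Phi> (x, t)) integrable_on cbox 0 1" for x
        by (intro integrable_continuous continuous_on_compose2[OF cont] continuous_intros) auto
    qed (use contL in auto)
    then show ?thesis by simp
  qed
  moreover have "blinfun_apply (integral {0..1} (L x)) v = integral {0..1} (\<lambda>t. ?D (x, t) (v, 0))" for x v
  proof -
    have "continuous_on {0..1} (\<lambda>t. case (x, t) of (x, t) \<Rightarrow> L x t)"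
      by (rule continuous_on_compose2[OF contL])
        (auto intro!: continuous_on_Pair continuous_on_id continuous_on_const)
    then have "continuous_on {0..1} (L x)" by simp
    then have "L x integrable_on {0..1}" by (rule integrable_continuous_interval)
    then show ?thesis
      using blinfun_apply_integral[of "L x" "{0..1}" v] by (simp add: L)
  qed
  ultimately show ?case
    by (intro Ck_on_SucI[OF open_UNIV, where f' = "\<lambda>x. blinfun_apply (integral {0..1} (L x))"])
      (auto intro!: Suc.IH \<Phi>(2))
qed

text \<open>
  Hadamard's lemma. Integrating \<open>d/dt F (a + t (y - a))\<close> over the unit interval gives
  \<open>F y - F a\<close>; the integrals of the partial derivatives along the segment are the \<open>h i\<close>. This is
  what makes a derivation, which is a purely algebraic object, a first order differential
  operator.
\<close>

lemma hadamard:
  fixes F :: "real ^ 'n::finite \<Rightarrow> real"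
  assumes "smooth_on UNIV F"
  obtains h where "\<And>i. smooth_on UNIV (h i)"
    and "\<And>y. F y = F a + (\<Sum>i\<in>UNIV. (y $ i - a $ i) * h i y)"
    and "\<And>i. h i a = frechet_derivative F (at a) (axis i 1)"
proof
  let ?D = "\<lambda>z. frechet_derivative F (at z)"
  define h where "h i y = integral {0..1} (\<lambda>t. ?D (a + t *\<^sub>R (y - a)) (axis i 1))" for i y
  note D = smooth_on_has_derivative[OF assms UNIV_I]
  note contD = smooth_on_imp_continuous_on[OF smooth_on_frechet_derivative[OF assms]]
  show "smooth_on UNIV (h i)" for i
  proof -
    have "smooth_on UNIV (\<lambda>z::(real^'n) \<times> real. a + snd z *\<^sub>R (fst z + - a))"
      by (intro smooth_on_add smooth_on_const smooth_on_bilinear[OF bounded_bilinear_scaleR]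
          smooth_on_linear bounded_linear_fst bounded_linear_snd open_UNIV)
    then have "smooth_on UNIV (\<lambda>z::(real^'n) \<times> real. ?D (a + snd z *\<^sub>R (fst z + - a)) (axis i 1))"
      by (intro smooth_on_comp[OF open_UNIV open_UNIV _ _ smooth_on_frechet_derivative[OF assms],
            where u = "\<lambda>z. a + snd z *\<^sub>R (fst z + - a)"]) auto
    then show ?thesis
      using Ck_on_integral_param unfolding smooth_on_def h_def by fastforce
  qed
  show "h i a = ?D a (axis i 1)" for i
    by (simp add: h_def)
  show "F y = F a + (\<Sum>i\<in>UNIV. (y $ i - a $ i) * h i y)" for y
  proof -
    let ?c = "\<lambda>t. a + t *\<^sub>R (y - a)"
    have "((\<lambda>t. F (?c t)) has_vector_derivative ?D (?c t) (y - a)) (at t within {0..1})" for t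
    proof -
      have "((\<lambda>t. F (?c t)) has_derivative (\<lambda>s. ?D (?c t) (s *\<^sub>R (y - a)))) (at t within {0..1})"
        by (rule has_derivative_compose[OF _ D]) (auto intro!: derivative_eq_intros)
      then show ?thesis
        by (simp add: has_vector_derivative_def linear_scale[OF has_derivative_linear[OF D]])
    qed
    then have 1: "((\<lambda>t. ?D (?c t) (y - a)) has_integral F (?c 1) - F (?c 0)) {0..1}"
      by (intro fundamental_theorem_of_calculus) auto
    have 2: "?D z (y - a) = (\<Sum>i\<in>UNIV. (y $ i - a $ i) * ?D z (axis i 1))" for z
    proof -
      have lin: "linear (?D z)" by (rule has_derivative_linear[OF D])
      have "y - a = (\<Sum>i\<in>UNIV. (y $ i - a $ i) *\<^sub>R axis i 1)"
        using basis_expansion[of "y - a"] by (simp add: scalar_mult_eq_scaleR)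
      then show ?thesis by (simp add: linear_sum[OF lin] linear_scale[OF lin])
    qed
    have int: "(\<lambda>t. (y $ i - a $ i) * ?D (?c t) (axis i 1)) integrable_on {0..1}" for i
      by (intro integrable_continuous_interval continuous_intros continuous_on_compose2[OF contD]) auto
    have "F y - F a = integral {0..1} (\<lambda>t. \<Sum>i\<in>UNIV. (y $ i - a $ i) * ?D (?c t) (axis i 1))"
      using integral_unique[OF 1] by (simp add: 2)
    also have "\<dots> = (\<Sum>i\<in>UNIV. (y $ i - a $ i) * h i y)"
      by (subst integral_sum) (auto simp: h_def int)
    finally show ?thesis by simp
  qed
qed

section \<open>Smooth functions and vector fields\<close>

lemma sum_fun_apply: "(\<Sum>i\<in>I. F i) x = (\<Sum>i\<in>I. F i x :: 'b::comm_monoid_add)"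
  by (induction I rule: infinite_finite_induct) auto

locale smooth_manifold =
  fixes A :: "('a::t2_space, 'n::finite) atlas"
  assumes atlas: "smooth_atlas A"
begin

abbreviation "C \<equiv> smooth_funs A"
abbreviation "VF \<equiv> vector_fields A"
abbreviation "\<Omega> \<equiv> one_forms A"

lemma chart_open: "(U, \<phi>) \<in> A \<Longrightarrow> open U"
  and chart_image_open: "(U, \<phi>) \<in> A \<Longrightarrow> open (\<phi> ` U)"
  and chart_homeomorphism: "(U, \<phi>) \<in> A \<Longrightarrow> homeomorphism U (\<phi> ` U) \<phi> (inv_into U \<phi>)"
  using atlas unfolding smooth_atlas_def by fast+

lemma chart_transition:
  "(U, \<phi>) \<in> A \<Longrightarrow> (V, \<psi>) \<in> A \<Longrightarrow> smooth_on (\<phi> ` (U \<inter> V)) (\<psi> \<circ> inv_into U \<phi>)"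
  using atlas unfolding smooth_atlas_def by fast

lemma chart_inverse: "(U, \<phi>) \<in> A \<Longrightarrow> x \<in> U \<Longrightarrow> inv_into U \<phi> (\<phi> x) = x"
  using homeomorphism_apply1[OF chart_homeomorphism] by blast

lemma chart_cover: obtains U \<phi> where "(U, \<phi>) \<in> A" "p \<in> U"
  using atlas unfolding smooth_atlas_def by fast

text \<open>
  A chart is a homeomorphism onto an open set, hence an open map. Smoothness of a function on
  the manifold is checked on the images of two overlapping open pieces of a chart.
\<close>

lemma chart_image_open_Int:
  assumes "(U, \<phi>) \<in> A" "open W" shows "open (\<phi> ` (U \<inter> W))"
proof -
  note h = chart_homeomorphism[OF assms(1)]
  have "\<phi> ` (U \<inter> W) = \<phi> ` U \<inter> inv_into U \<phi> -` W"
    using chart_inverse[OF assms(1)] by force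
  then show ?thesis
    using continuous_open_preimage[OF homeomorphism_cont2[OF h] chart_image_open[OF assms(1)] assms(2)]
    by simp
qed

lemma smooth_funsD: "f \<in> C \<Longrightarrow> (U, \<phi>) \<in> A \<Longrightarrow> smooth_on (\<phi> ` U) (\<lambda>y. f (inv_into U \<phi> y))"
  by (auto simp: smooth_funs_def o_def)

lemma smooth_funsI:
  "(\<And>U \<phi>. (U, \<phi>) \<in> A \<Longrightarrow> smooth_on (\<phi> ` U) (\<lambda>y. f (inv_into U \<phi> y))) \<Longrightarrow> f \<in> C"
  by (auto simp: smooth_funs_def o_def)

lemma const_smooth [simp, intro]: "(\<lambda>_. c) \<in> C"
  by (intro smooth_funsI smooth_on_const)

lemma zero_smooth [simp, intro]: "0 \<in> C" and one_smooth [simp, intro]: "1 \<in> C"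
  using const_smooth[of 0] const_smooth[of 1] by (simp_all add: zero_fun_def one_fun_def)

lemma add_smooth [intro]: "f \<in> C \<Longrightarrow> h \<in> C \<Longrightarrow> f + h \<in> C"
  by (rule smooth_funsI) (simp add: chart_image_open smooth_funsD smooth_on_add)

lemma mult_smooth [intro]: "f \<in> C \<Longrightarrow> h \<in> C \<Longrightarrow> f * h \<in> C"
  by (rule smooth_funsI) (simp add: chart_image_open smooth_funsD smooth_on_mult)

lemma uminus_smooth [intro]: "f \<in> C \<Longrightarrow> - f \<in> C"
  using mult_smooth[OF const_smooth[of "- 1"], of f] by (simp add: fun_Compl_def times_fun_def)

lemma diff_smooth [intro]: "f \<in> C \<Longrightarrow> h \<in> C \<Longrightarrow> f - h \<in> C"
  using add_smooth[of f "- h"] by auto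

lemma sum_smooth [intro]: "(\<And>i. i \<in> I \<Longrightarrow> f i \<in> C) \<Longrightarrow> (\<Sum>i\<in>I. f i) \<in> C"
  by (induction I rule: infinite_finite_induct) auto

lemma comp_smooth:
  fixes \<kappa> :: "real \<Rightarrow> real"
  assumes "u \<in> C" "open T" "range u \<subseteq> T" "smooth_on T \<kappa>"
  shows "(\<lambda>m. \<kappa> (u m)) \<in> C"
proof (rule smooth_funsI)
  fix U \<phi> assume U: "(U, \<phi>) \<in> A"
  show "smooth_on (\<phi> ` U) (\<lambda>y. \<kappa> (u (inv_into U \<phi> y)))"
    by (rule smooth_on_comp[OF chart_image_open[OF U] assms(2) _ smooth_funsD[OF assms(1) U] assms(4)])
      (use assms(3) in auto)
qed

lemma smooth_continuous: assumes "f \<in> C" shows "continuous_on UNIV f"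
proof -
  have "isCont f p" for p
  proof -
    obtain U \<phi> where U: "(U, \<phi>) \<in> A" "p \<in> U" by (rule chart_cover)
    have "continuous_on U (\<lambda>m. f (inv_into U \<phi> (\<phi> m)))"
      by (rule continuous_on_compose2[OF smooth_on_imp_continuous_on[OF smooth_funsD[OF assms U(1)]]
            homeomorphism_cont1[OF chart_homeomorphism[OF U(1)]]]) simp
    then have "continuous_on U f"
      by (rule continuous_on_eq) (simp add: chart_inverse[OF U(1)])
    then show ?thesis
      using continuous_on_eq_continuous_at[OF chart_open[OF U(1)]] U(2) by blast
  qed
  then show ?thesis by (simp add: continuous_at_imp_continuous_on)
qed

lemma vf_smooth: "X \<in> VF \<Longrightarrow> f \<in> C \<Longrightarrow> X f \<in> C"
  and vf_outside: "X \<in> VF \<Longrightarrow> f \<notin> C \<Longrightarrow> X f = 0"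
  and vf_add: "X \<in> VF \<Longrightarrow> f \<in> C \<Longrightarrow> h \<in> C \<Longrightarrow> X (f + h) = X f + X h"
  and vf_const_mult: "X \<in> VF \<Longrightarrow> f \<in> C \<Longrightarrow> X ((\<lambda>_. c) * f) = (\<lambda>_. c) * X f"
  and vf_mult: "X \<in> VF \<Longrightarrow> f \<in> C \<Longrightarrow> h \<in> C \<Longrightarrow> X (f * h) = f * X h + X f * h"
  unfolding vector_fields_def by auto

lemma vf_zero: "X \<in> VF \<Longrightarrow> X 0 = 0"
  using vf_add[of X 0 0] by simp

lemma vf_uminus: "X \<in> VF \<Longrightarrow> f \<in> C \<Longrightarrow> X (- f) = - X f"
  using vf_const_mult[of X f "- 1"] by (simp add: fun_Compl_def times_fun_def)

lemma vf_diff: "X \<in> VF \<Longrightarrow> f \<in> C \<Longrightarrow> h \<in> C \<Longrightarrow> X (f - h) = X f - X h"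
  using vf_add[of X f "- h"] vf_uminus[of X h] uminus_smooth[of h] by simp

lemma vf_sum: "X \<in> VF \<Longrightarrow> (\<And>i. i \<in> I \<Longrightarrow> f i \<in> C) \<Longrightarrow> X (\<Sum>i\<in>I. f i) = (\<Sum>i\<in>I. X (f i))"
  by (induction I rule: infinite_finite_induct) (auto simp: vf_zero vf_add sum_smooth)

lemma vector_fieldI:
  assumes "\<And>f. f \<notin> C \<Longrightarrow> X f = 0" "\<And>f. f \<in> C \<Longrightarrow> X f \<in> C"
    "\<And>f h. f \<in> C \<Longrightarrow> h \<in> C \<Longrightarrow> X (f + h) = X f + X h"
    "\<And>c f. f \<in> C \<Longrightarrow> X ((\<lambda>_. c) * f) = (\<lambda>_. c) * X f"
    "\<And>f h. f \<in> C \<Longrightarrow> h \<in> C \<Longrightarrow> X (f * h) = f * X h + X f * h"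
  shows "X \<in> VF"
  using assms unfolding vector_fields_def by simp

end

section \<open>Coordinate fields and the expansion of derivations\<close>

text \<open>
  A chart together with a closed ball of radius \<open>2 * r\<close> in its image. The ball leaves room for two
  bump functions: \<open>outer_bump\<close> is 1 on the ball of radius \<open>r\<close>, and \<open>inner_bump\<close> vanishes off that ball, so
  that \<open>outer_bump\<close> is invisible wherever \<open>inner_bump\<close> is nonzero.
\<close>

locale chart_ball = smooth_manifold A for A :: "('a::t2_space, 'n::finite) atlas" +
  fixes U :: "'a set" and \<phi> :: "'a \<Rightarrow> real ^ 'n" and q :: "real ^ 'n" and r :: real
  assumes chart: "(U, \<phi>) \<in> A" and r: "r > 0" and ball: "cball q (2 * r) \<subseteq> \<phi> ` U"
begin

definition outer_bump :: "real ^ 'n \<Rightarrow> real" where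
  "outer_bump y = cutoff (inverse (r\<^sup>2) * ((y - q) \<bullet> (y - q)))"

definition inner_bump :: "real ^ 'n \<Rightarrow> real" where
  "inner_bump y = cutoff (2 * inverse (r\<^sup>2) * ((y - q) \<bullet> (y - q)))"

lemma smooth_on_norm_cutoff: "smooth_on UNIV (\<lambda>y::real^'n. cutoff (c * ((y - q) \<bullet> (y - q))))"
proof -
  have id: "smooth_on UNIV (\<lambda>y::real^'n. y + - q)"
    by (intro smooth_on_add smooth_on_const smooth_on_linear bounded_linear_ident open_UNIV)
  have "smooth_on UNIV (\<lambda>y. c * ((y + - q) \<bullet> (y + - q)))"
    by (intro smooth_on_mult smooth_on_const smooth_on_bilinear[OF bounded_bilinear_inner] id open_UNIV)
  then have "smooth_on UNIV (\<lambda>y. cutoff (c * ((y + - q) \<bullet> (y + - q))))"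
    by (intro smooth_on_comp[OF open_UNIV open_UNIV _ _ smooth_on_cutoff,
          where u = "\<lambda>y. c * ((y + - q) \<bullet> (y + - q))"]) auto
  then show ?thesis by simp
qed

lemma smooth_outer_bump: "smooth_on UNIV outer_bump" and smooth_inner_bump: "smooth_on UNIV inner_bump"
  unfolding outer_bump_def[abs_def] inner_bump_def[abs_def] by (rule smooth_on_norm_cutoff)+

lemma sq_dist: "(y - q) \<bullet> (y - q) = (dist q y)\<^sup>2"
  by (metis dist_commute dist_norm power2_norm_eq_inner)

lemma outer_bump_one: assumes "dist q y \<le> r" shows "outer_bump y = 1"
  unfolding outer_bump_def sq_dist using r assms
  by (intro cutoff_one) (simp add: field_simps power_mono)

lemma outer_bump_zero: assumes "y \<notin> cball q (2 * r)" shows "outer_bump y = 0"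
proof -
  have "(2 * r)\<^sup>2 \<le> (dist q y)\<^sup>2" using r assms by (intro power_mono) auto
  then have "4 * r\<^sup>2 \<le> (dist q y)\<^sup>2" by (simp add: power_mult_distrib)
  moreover have "0 \<le> r\<^sup>2" by simp
  ultimately have "2 * r\<^sup>2 \<le> (dist q y)\<^sup>2" by linarith
  then show ?thesis
    unfolding outer_bump_def sq_dist using r by (intro cutoff_zero) (simp add: field_simps)
qed

lemma inner_bump_zero: assumes "inner_bump y \<noteq> 0" shows "dist q y < r"
proof (rule ccontr)
  assume "\<not> dist q y < r"
  then have "r\<^sup>2 \<le> (dist q y)\<^sup>2" using r by (intro power_mono) auto
  then have "inner_bump y = 0"
    unfolding inner_bump_def sq_dist using r by (intro cutoff_zero) (simp add: field_simps)
  with assms show False by simp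
qed

lemma inner_bump_center: "inner_bump q = 1"
  by (simp add: inner_bump_def cutoff_one)

lemma inner_bump_support: "y \<notin> cball q (2 * r) \<Longrightarrow> inner_bump y = 0"
  using inner_bump_zero[of y] r by force

definition lift :: "(real ^ 'n \<Rightarrow> real) \<Rightarrow> 'a sfun" where
  "lift H m = (if m \<in> U then H (\<phi> m) else 0)"

text \<open>
  Extension by zero of a function with compact support in a chart. The preimage of the
  ball is compact, hence closed in the Hausdorff space; any other chart is covered by its overlap with
  \<open>U\<close>, where the function is a smooth function of the coordinates, and the complement of
  that compact set, where it vanishes.
\<close>

lemma lift_smooth:
  assumes H: "smooth_on UNIV H" and supp: "\<And>y. y \<notin> cball q (2 * r) \<Longrightarrow> H y = 0"
  shows "lift H \<in> C"
proof (rule smooth_funsI)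
  fix V \<psi> assume V: "(V, \<psi>) \<in> A"
  define K where "K = inv_into U \<phi> ` cball q (2 * r)"
  note h = chart_homeomorphism[OF chart]
  have "compact K"
    unfolding K_def
    by (rule compact_continuous_image[OF continuous_on_subset[OF homeomorphism_cont2[OF h] ball] compact_cball])
  then have "open (- K)" by (simp add: compact_imp_closed open_Compl)
  then have S2: "open (\<psi> ` (V \<inter> - K))" by (rule chart_image_open_Int[OF V])
  have S1: "open (\<psi> ` (V \<inter> U))" by (rule chart_image_open_Int[OF V chart_open[OF chart]])
  have "smooth_on (\<psi> ` (V \<inter> U)) (\<lambda>y. H ((\<phi> \<circ> inv_into V \<psi>) y))"
    by (rule smooth_on_comp[OF S1 open_UNIV _ chart_transition[OF V chart] H]) simp
  then have 1: "smooth_on (\<psi> ` (V \<inter> U)) (\<lambda>y. lift H (inv_into V \<psi> y))"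
    by (rule smooth_on_cong[OF _ S1]) (auto simp: lift_def chart_inverse[OF V])
  have z: "lift H m = 0" if "m \<notin> K" for m
    using that supp chart_inverse[OF chart] unfolding lift_def K_def by (metis imageI)
  have 2: "smooth_on (\<psi> ` (V \<inter> - K)) (\<lambda>y. lift H (inv_into V \<psi> y))"
    by (rule smooth_on_cong[OF smooth_on_const[of _ 0] S2]) (auto simp: z chart_inverse[OF V])
  have "K \<subseteq> U"
    using ball homeomorphism_image2[OF h] unfolding K_def by blast
  then have "\<psi> ` V = \<psi> ` (V \<inter> U) \<union> \<psi> ` (V \<inter> - K)" by blast
  then show "smooth_on (\<psi> ` V) (\<lambda>y. lift H (inv_into V \<psi> y))"
    using smooth_on_Un[OF S1 S2 1 2] by simp
qed

text \<open>
  Cutting off makes the coordinate expression of a function smooth on the whole coordinate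
  space, so that Hadamard's lemma applies with no condition on the domain.
\<close>

definition coord_rep :: "'a sfun \<Rightarrow> real ^ 'n \<Rightarrow> real" where
  "coord_rep f y = (if y \<in> \<phi> ` U then outer_bump y * f (inv_into U \<phi> y) else 0)"

lemma coord_rep_smooth: assumes "f \<in> C" shows "smooth_on UNIV (coord_rep f)"
proof -
  note o = chart_image_open[OF chart]
  have 1: "smooth_on (\<phi> ` U) (coord_rep f)"
    by (rule smooth_on_cong[OF smooth_on_mult[OF o smooth_on_subset[OF smooth_outer_bump] smooth_funsD[OF assms chart]] o])
      (auto simp: coord_rep_def)
  have 2: "smooth_on (- cball q (2 * r)) (coord_rep f)"
    by (rule smooth_on_cong[OF smooth_on_const[of _ 0]]) (auto simp: coord_rep_def outer_bump_zero open_Compl)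
  have "\<phi> ` U \<union> - cball q (2 * r) = UNIV" using ball by blast
  then show ?thesis using smooth_on_Un[OF o _ 1 2] by (simp add: open_Compl)
qed

definition coord :: "'n \<Rightarrow> 'a sfun" where
  "coord i = lift (\<lambda>y. outer_bump y * y $ i)"

text \<open>
  Partial derivatives exist on the chart only; the factor \<open>inner_bump\<close> turns them into global
  vector fields that keep their direction wherever it does not vanish.
\<close>

definition coord_field :: "'n \<Rightarrow> 'a vfield" where
  "coord_field i f =
    (if f \<in> C then lift (\<lambda>y. inner_bump y * frechet_derivative (coord_rep f) (at y) (axis i 1)) else 0)"

lemma lift_outer_smooth: "smooth_on UNIV H \<Longrightarrow> lift (\<lambda>y. outer_bump y * H y) \<in> C"
  by (rule lift_smooth) (auto intro: smooth_on_mult smooth_outer_bump simp: outer_bump_zero)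

lemma lift_inner_smooth: "smooth_on UNIV H \<Longrightarrow> lift (\<lambda>y. inner_bump y * H y) \<in> C"
  by (rule lift_smooth) (auto intro: smooth_on_mult smooth_inner_bump simp: inner_bump_support)

lemma lift_bumps_smooth: "lift outer_bump \<in> C" "lift inner_bump \<in> C"
  using lift_outer_smooth[OF smooth_on_const[of _ 1]] lift_inner_smooth[OF smooth_on_const[of _ 1]]
  by simp_all

lemma coord_smooth: "coord i \<in> C"
  unfolding coord_def by (intro lift_outer_smooth smooth_on_linear bounded_linear_vec_nth)

text \<open>
  The Leibniz rule is the only delicate axiom: \<open>coord_rep\<close> is multiplicative only where \<open>outer_bump\<close> is 1,
  which is a neighbourhood of every point at which \<open>inner_bump\<close> does not vanish.
\<close>

lemma coord_field_vf: "coord_field i \<in> VF"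
proof (rule vector_fieldI)
  note der = smooth_on_has_derivative[OF coord_rep_smooth UNIV_I]
  note fd = frechet_derivative_at[symmetric]
  let ?e = "axis i 1 :: real ^ 'n"
  show "coord_field i f \<in> C" if "f \<in> C" for f
    unfolding coord_field_def
    using that by (simp add: lift_inner_smooth smooth_on_frechet_derivative coord_rep_smooth)
  show "coord_field i (f + h) = coord_field i f + coord_field i h" if f: "f \<in> C" and h: "h \<in> C" for f h
  proof -
    have "coord_rep (f + h) = (\<lambda>y. coord_rep f y + coord_rep h y)" by (auto simp: coord_rep_def fun_eq_iff algebra_simps)
    then show ?thesis
      using f h fd[OF has_derivative_add[OF der[OF f] der[OF h]]]
      by (simp add: coord_field_def add_smooth) (auto simp: lift_def fun_eq_iff algebra_simps)
  qed
  show "coord_field i ((\<lambda>_. c) * f) = (\<lambda>_. c) * coord_field i f" if f: "f \<in> C" for c f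
  proof -
    have "coord_rep ((\<lambda>_. c) * f) = (\<lambda>y. c * coord_rep f y)" by (auto simp: coord_rep_def fun_eq_iff algebra_simps)
    then show ?thesis
      using f fd[OF has_derivative_mult_right[OF der[OF f], of c]]
      by (simp add: coord_field_def mult_smooth) (auto simp: lift_def fun_eq_iff algebra_simps)
  qed
  show "coord_field i (f * h) = f * coord_field i h + coord_field i f * h"
    if f: "f \<in> C" and h: "h \<in> C" for f h
  proof
    fix m
    show "coord_field i (f * h) m = (f * coord_field i h + coord_field i f * h) m"
    proof (cases "m \<in> U \<and> inner_bump (\<phi> m) \<noteq> 0")
      case False
      then show ?thesis using f h by (auto simp: coord_field_def lift_def mult_smooth)
    next
      case True
      let ?y = "\<phi> m"
      have y: "?y \<in> ball q r" using True inner_bump_zero by simp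
      have "((\<lambda>y. coord_rep f y * coord_rep h y) has_derivative
          (\<lambda>v. coord_rep f ?y * frechet_derivative (coord_rep h) (at ?y) v +
               frechet_derivative (coord_rep f) (at ?y) v * coord_rep h ?y)) (at ?y)"
        by (rule has_derivative_mult[OF der[OF f] der[OF h]])
      then have "(coord_rep (f * h) has_derivative
          (\<lambda>v. coord_rep f ?y * frechet_derivative (coord_rep h) (at ?y) v +
               frechet_derivative (coord_rep f) (at ?y) v * coord_rep h ?y)) (at ?y)"
        by (rule has_derivative_transform_within_open[OF _ open_ball y])
          (auto simp: coord_rep_def outer_bump_one)
      from fd[OF this] True y show ?thesis
        using f h
        by (auto simp: coord_field_def lift_def mult_smooth coord_rep_def chart_inverse[OF chart] outer_bump_one
            algebra_simps)
    qed
  qed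
qed (simp add: coord_field_def)

lemma coord_field_coord:
  assumes "p \<in> U" "\<phi> p = q" shows "coord_field i (coord j) p = (if i = j then 1 else 0)"
proof -
  have "((\<lambda>y. y $ j) has_derivative (\<lambda>v::real^'n. v $ j)) (at q)"
    by (rule bounded_linear_imp_has_derivative[OF bounded_linear_vec_nth])
  then have "(coord_rep (coord j) has_derivative (\<lambda>v::real^'n. v $ j)) (at q)"
  proof (rule has_derivative_transform_within_open[OF _ open_ball])
    show "q \<in> ball q r" using r by simp
    fix y assume "y \<in> ball q r"
    moreover from this ball r have "y \<in> \<phi> ` U" by auto
    ultimately show "y $ j = coord_rep (coord j) y"
      by (auto simp: coord_rep_def coord_def lift_def outer_bump_one chart_inverse[OF chart])
  qed
  from frechet_derivative_at[OF this, symmetric] assms show ?thesis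
    by (auto simp: coord_field_def coord_smooth lift_def inner_bump_center axis_def)
qed

text \<open>
  A derivation is the sum of its values on the coordinates times the coordinate fields.
  Fix a point where \<open>inner_bump\<close> does not vanish. There the derivation kills the lift \<open>\<chi>\<close> of
  \<open>outer_bump\<close>, because \<open>\<rho> * \<chi> = \<rho>\<close> for the lift \<open>\<rho>\<close> of \<open>inner_bump\<close>. Hadamard's lemma, multiplied by
  enough copies of \<open>\<chi>\<close> to become an identity between global smooth functions, writes \<open>f\<close>, up to
  factors \<open>\<chi>\<close>, as a constant plus products of functions \<open>?z i\<close> vanishing at the point with smooth functions, and the
  Leibniz rule evaluates the derivation on it. This replaces any appeal to the locality of
  derivations.
\<close>

lemma coord_expansion:
  assumes X: "X \<in> VF" and f: "f \<in> C"
  shows "lift inner_bump * X f = (\<Sum>i\<in>UNIV. X (coord i) * coord_field i f)"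
proof
  fix m
  let ?\<rho> = "lift inner_bump" and ?\<chi> = "lift outer_bump"
  show "(?\<rho> * X f) m = (\<Sum>i\<in>UNIV. X (coord i) * coord_field i f) m"
  proof (cases "m \<in> U \<and> inner_bump (\<phi> m) \<noteq> 0")
    case False
    then show ?thesis using f by (auto simp: sum_fun_apply coord_field_def lift_def)
  next
    case True
    define a where "a = \<phi> m"
    have \<chi>m: "?\<chi> m = 1" using True inner_bump_zero[of a] by (simp add: lift_def outer_bump_one a_def)
    note [simp] = lift_bumps_smooth
    have "?\<rho> * ?\<chi> = ?\<rho>"
      using inner_bump_zero outer_bump_one by (fastforce simp: lift_def fun_eq_iff)
    then have "?\<rho> * X ?\<chi> + X ?\<rho> * ?\<chi> = X ?\<rho>"
      using vf_mult[OF X, of ?\<rho> ?\<chi>] by simp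
    from fun_cong[OF this, of m] have "?\<rho> m * X ?\<chi> m + X ?\<rho> m * ?\<chi> m = X ?\<rho> m" by simp
    then have X\<chi>: "X ?\<chi> m = 0" using True \<chi>m by (simp add: lift_def)
    obtain h where h: "\<And>i. smooth_on UNIV (h i)"
      "\<And>y. coord_rep f y = coord_rep f a + (\<Sum>i\<in>UNIV. (y $ i - a $ i) * h i y)"
      "\<And>i. h i a = frechet_derivative (coord_rep f) (at a) (axis i 1)"
      using hadamard[OF coord_rep_smooth[OF f], of a] by blast
    define k where "k i = lift (\<lambda>y. outer_bump y * h i y)" for i
    have k: "k i \<in> C" for i unfolding k_def by (rule lift_outer_smooth[OF h(1)])
    let ?z = "\<lambda>i. coord i - (\<lambda>_. a $ i) * ?\<chi>"
    have z: "?z i \<in> C" for i by (intro diff_smooth mult_smooth coord_smooth const_smooth lift_bumps_smooth)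
    \<comment> \<open>one factor \<open>?\<chi>\<close> turns \<open>f\<close> into \<open>coord_rep f\<close>, the other two make \<open>?z i\<close> and \<open>k i\<close> global\<close>
    have eq: "?\<chi> * (?\<chi> * (?\<chi> * f)) = (\<lambda>_. coord_rep f a) * (?\<chi> * ?\<chi>) + (\<Sum>i\<in>UNIV. ?z i * k i)"
    proof
      fix m'
      show "(?\<chi> * (?\<chi> * (?\<chi> * f))) m' = ((\<lambda>_. coord_rep f a) * (?\<chi> * ?\<chi>) + (\<Sum>i\<in>UNIV. ?z i * k i)) m'"
      proof (cases "m' \<in> U")
        case False
        then show ?thesis by (simp add: lift_def sum_fun_apply k_def)
      next
        case U: True
        let ?y = "\<phi> m'"
        have "(?\<chi> * (?\<chi> * (?\<chi> * f))) m' = outer_bump ?y * outer_bump ?y * coord_rep f ?y"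
          using U by (simp add: lift_def coord_rep_def chart_inverse[OF chart])
        also have "\<dots> = outer_bump ?y * outer_bump ?y * coord_rep f a +
            (\<Sum>i\<in>UNIV. outer_bump ?y * outer_bump ?y * ((?y $ i - a $ i) * h i ?y))"
          by (subst h(2)) (simp add: sum_distrib_left ring_distribs)
        also have "(\<Sum>i\<in>UNIV. outer_bump ?y * outer_bump ?y * ((?y $ i - a $ i) * h i ?y)) =
            (\<Sum>i\<in>UNIV. ?z i m' * k i m')"
          using U by (intro sum.cong) (auto simp: coord_def lift_def k_def algebra_simps)
        finally show ?thesis using U by (simp add: sum_fun_apply lift_def)
      qed
    qed
    have "X (?\<chi> * (?\<chi> * (?\<chi> * f))) m = X f m"
      by (simp add: vf_mult[OF X] f mult_smooth \<chi>m X\<chi>)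
    moreover have "X ((\<lambda>_. coord_rep f a) * (?\<chi> * ?\<chi>) + (\<Sum>i\<in>UNIV. ?z i * k i)) m =
        (\<Sum>i\<in>UNIV. X (?z i * k i) m)"
      using z k by (simp add: vf_add[OF X] vf_const_mult[OF X] vf_sum[OF X] vf_mult[OF X] mult_smooth
          sum_smooth X\<chi> sum_fun_apply)
    moreover have "X (?z i * k i) m = X (coord i) m * frechet_derivative (coord_rep f) (at a) (axis i 1)" for i
    proof -
      have "?z i m = 0" using True \<chi>m by (simp add: coord_def lift_def a_def)
      moreover have "X (?z i) m = X (coord i) m"
        by (simp add: vf_diff[OF X] vf_const_mult[OF X] coord_smooth mult_smooth X\<chi>)
      moreover have "k i m = h i a" using True \<chi>m by (simp add: k_def lift_def a_def)
      ultimately show ?thesis using h(3) by (simp add: vf_mult[OF X z k])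
    qed
    ultimately have "X f m = (\<Sum>i\<in>UNIV. X (coord i) m * frechet_derivative (coord_rep f) (at a) (axis i 1))"
      using eq by simp
    then show ?thesis
      using True f
      by (simp add: sum_fun_apply coord_field_def lift_def a_def sum_distrib_left algebra_simps)
  qed
qed

end

context smooth_manifold begin

text \<open>
  Coordinates and coordinate fields at \<open>p\<close>, made global: the price is the smooth factor \<open>\<rho>\<close>, which
  is harmless at \<open>p\<close>.
\<close>

lemma coordinate_frame:
  obtains \<rho> :: "'a sfun" and x :: "'n \<Rightarrow> 'a sfun" and e :: "'n \<Rightarrow> 'a vfield"
  where "\<rho> \<in> C" "\<rho> p = 1" "\<And>i. x i \<in> C" "\<And>i. e i \<in> VF"
    "\<And>i j. e i (x j) p = (if i = j then 1 else 0)"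
    "\<And>X f. X \<in> VF \<Longrightarrow> f \<in> C \<Longrightarrow> \<rho> * X f = (\<Sum>i\<in>UNIV. X (x i) * e i f)"
proof -
  obtain U \<phi> where U: "(U, \<phi>) \<in> A" "p \<in> U" by (rule chart_cover)
  obtain s where s: "s > 0" "cball (\<phi> p) s \<subseteq> \<phi> ` U"
    using chart_image_open[OF U(1)] U(2) open_contains_cball by (metis imageI)
  interpret chart_ball A U \<phi> "\<phi> p" "s / 2"
    by unfold_locales (use U s in auto)
  show ?thesis
    by (rule that[of "lift inner_bump" coord coord_field])
      (simp_all add: lift_bumps_smooth coord_smooth coord_field_vf coord_field_coord U coord_expansion,
       simp add: lift_def U inner_bump_center)
qed

end

section \<open>Modules of vector fields and 1-forms\<close>

lemma smult_apply: "(f \<cdot>\<^sub>s T) x = f * T x"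
  by (simp add: smult_def)

context smooth_manifold begin

text \<open>
  Vector fields and 1-forms are both modules of functions over the smooth functions. The
  notions below treat them together; \<open>tensorial\<close> maps are the module homomorphisms into the
  smooth functions, the partial maps of every bilinear tensor being examples.
\<close>

definition submodule :: "('b \<Rightarrow> 'a sfun) set \<Rightarrow> bool" where
  "submodule E \<longleftrightarrow> 0 \<in> E \<and> (\<forall>x\<in>E. \<forall>y\<in>E. x + y \<in> E) \<and> (\<forall>f\<in>C. \<forall>x\<in>E. f \<cdot>\<^sub>s x \<in> E)"

definition tensorial :: "('b \<Rightarrow> 'a sfun) set \<Rightarrow> (('b \<Rightarrow> 'a sfun) \<Rightarrow> 'a sfun) \<Rightarrow> bool" where
  "tensorial E F \<longleftrightarrow> (\<forall>x\<in>E. \<forall>y\<in>E. F (x + y) = F x + F y) \<and> (\<forall>f\<in>C. \<forall>x\<in>E. F (f \<cdot>\<^sub>s x) = f * F x)"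

lemma submodule_sum:
  assumes "submodule E" "\<And>i. i \<in> I \<Longrightarrow> f i \<in> C" "\<And>i. i \<in> I \<Longrightarrow> x i \<in> E"
  shows "(\<Sum>i\<in>I. f i \<cdot>\<^sub>s x i) \<in> E"
  using assms by (induction I rule: infinite_finite_induct) (auto simp: submodule_def)

lemma tensorial_add: "tensorial E F \<Longrightarrow> x \<in> E \<Longrightarrow> y \<in> E \<Longrightarrow> F (x + y) = F x + F y"
  and tensorial_smult: "tensorial E F \<Longrightarrow> f \<in> C \<Longrightarrow> x \<in> E \<Longrightarrow> F (f \<cdot>\<^sub>s x) = f * F x"
  by (simp_all add: tensorial_def)

lemma tensorial_zero: "submodule E \<Longrightarrow> tensorial E F \<Longrightarrow> F 0 = 0"
  using tensorial_add[of E F 0 0] by (simp add: submodule_def)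

lemma tensorial_sum:
  assumes "submodule E" "tensorial E F" "\<And>i. i \<in> I \<Longrightarrow> f i \<in> C" "\<And>i. i \<in> I \<Longrightarrow> x i \<in> E"
  shows "F (\<Sum>i\<in>I. f i \<cdot>\<^sub>s x i) = (\<Sum>i\<in>I. f i * F (x i))"
  using assms(3,4)
proof (induction I rule: infinite_finite_induct)
  case (insert i I)
  have "(\<Sum>i\<in>I. f i \<cdot>\<^sub>s x i) \<in> E"
    by (rule submodule_sum[OF assms(1)]) (use insert.prems in auto)
  moreover have "f i \<cdot>\<^sub>s x i \<in> E" using insert.prems assms(1) by (auto simp: submodule_def)
  ultimately have "F (f i \<cdot>\<^sub>s x i + (\<Sum>i\<in>I. f i \<cdot>\<^sub>s x i)) = F (f i \<cdot>\<^sub>s x i) + F (\<Sum>i\<in>I. f i \<cdot>\<^sub>s x i)"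
    using tensorial_add[OF assms(2)] by blast
  also have "F (f i \<cdot>\<^sub>s x i) = f i * F (x i)"
    using insert.prems by (intro tensorial_smult[OF assms(2)]) auto
  also have "F (\<Sum>i\<in>I. f i \<cdot>\<^sub>s x i) = (\<Sum>i\<in>I. f i * F (x i))"
    using insert.prems by (intro insert.IH) auto
  finally have "F (f i \<cdot>\<^sub>s x i + (\<Sum>i\<in>I. f i \<cdot>\<^sub>s x i)) = f i * F (x i) + (\<Sum>i\<in>I. f i * F (x i))" .
  then show ?case by (simp only: sum.insert[OF insert(1,2)])
qed (simp_all add: tensorial_zero[OF assms(1,2)])

lemma smult_zero: "f \<cdot>\<^sub>s 0 = 0"
  by (rule ext) (simp add: smult_apply)

lemma sbilinear_tensorial:
  assumes "sbilinear A E T" "x \<in> E"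
  shows "tensorial E (T x)" "tensorial E (\<lambda>y. T y x)"
  using assms by (auto simp: sbilinear_def tensorial_def)

lemma sbilinear_smooth: "sbilinear A E T \<Longrightarrow> x \<in> E \<Longrightarrow> y \<in> E \<Longrightarrow> T x y \<in> C"
  by (simp add: sbilinear_def)

lemma smult_uminus_one: "(\<lambda>_. - 1) \<cdot>\<^sub>s x = - x"
  by (simp add: smult_def fun_eq_iff)

lemma submodule_uminus: "submodule E \<Longrightarrow> x \<in> E \<Longrightarrow> - x \<in> E"
  unfolding submodule_def by (metis const_smooth smult_uminus_one)

lemma submodule_diff: "submodule E \<Longrightarrow> x \<in> E \<Longrightarrow> y \<in> E \<Longrightarrow> x - y \<in> E"
  using submodule_uminus[of E y] unfolding submodule_def by (metis diff_conv_add_uminus)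

lemma tensorial_uminus:
  assumes "tensorial E F" "x \<in> E" shows "F (- x) = - F x"
  using tensorial_smult[OF assms(1) const_smooth[of "- 1"] assms(2)]
  by (simp add: smult_uminus_one) (simp add: fun_eq_iff)

lemma tensorial_diff:
  assumes "submodule E" "tensorial E F" "x \<in> E" "y \<in> E" shows "F (x - y) = F x - F y"
  using tensorial_add[OF assms(2,3) submodule_uminus[OF assms(1,4)]] tensorial_uminus[OF assms(2,4)] by simp

text \<open>
  Apply the Leibniz rule to \<open>1 * 1\<close>.
\<close>

lemma vf_const: assumes X: "X \<in> VF" shows "X (\<lambda>_. c) = 0"
proof -
  have "X 1 = 0" using vf_mult[OF X, of 1 1] by simp
  then show ?thesis using vf_const_mult[OF X one_smooth, of c] by simp
qed

lemma VF_submodule: "submodule VF"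
  unfolding submodule_def
proof (intro conjI ballI)
  show "0 \<in> VF" by (rule vector_fieldI) auto
  show "X + Y \<in> VF" if X: "X \<in> VF" and Y: "Y \<in> VF" for X Y
    by (rule vector_fieldI)
      (auto simp: vf_outside[OF X] vf_outside[OF Y] vf_smooth[OF X] vf_smooth[OF Y] vf_add[OF X] vf_add[OF Y]
        vf_const[OF X] vf_const[OF Y] vf_const_mult[OF X] vf_const_mult[OF Y] vf_mult[OF X] vf_mult[OF Y] algebra_simps)
  show "f \<cdot>\<^sub>s X \<in> VF" if f: "f \<in> C" and X: "X \<in> VF" for f X
    by (rule vector_fieldI)
      (auto simp: smult_apply f vf_outside[OF X] vf_smooth[OF X] vf_add[OF X] vf_const[OF X] vf_const_mult[OF X]
        vf_mult[OF X] algebra_simps)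
qed

lemma form_smooth: "\<omega> \<in> \<Omega> \<Longrightarrow> X \<in> VF \<Longrightarrow> \<omega> X \<in> C"
  and form_outside: "\<omega> \<in> \<Omega> \<Longrightarrow> X \<notin> VF \<Longrightarrow> \<omega> X = 0"
  and form_tensorial: "\<omega> \<in> \<Omega> \<Longrightarrow> tensorial VF \<omega>"
  by (auto simp: one_forms_def tensorial_def)

lemma one_formI:
  assumes "\<And>X. X \<notin> VF \<Longrightarrow> \<omega> X = 0" "\<And>X. X \<in> VF \<Longrightarrow> \<omega> X \<in> C" "tensorial VF \<omega>"
  shows "\<omega> \<in> \<Omega>"
  using assms by (auto simp: one_forms_def tensorial_def)

lemma forms_submodule: "submodule \<Omega>"
  unfolding submodule_def
proof (intro conjI ballI)
  show "0 \<in> \<Omega>" by (rule one_formI) (auto simp: tensorial_def)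
  have VF: "\<And>Y Z. Y \<in> VF \<Longrightarrow> Z \<in> VF \<Longrightarrow> Y + Z \<in> VF" "\<And>f Y. f \<in> C \<Longrightarrow> Y \<in> VF \<Longrightarrow> f \<cdot>\<^sub>s Y \<in> VF"
    using VF_submodule by (auto simp: submodule_def)
  show "\<omega> + \<eta> \<in> \<Omega>" if \<omega>: "\<omega> \<in> \<Omega>" and \<eta>: "\<eta> \<in> \<Omega>" for \<omega> \<eta>
  proof (rule one_formI)
    note lin = form_tensorial[OF \<omega>] form_tensorial[OF \<eta>]
    show "tensorial VF (\<omega> + \<eta>)"
      unfolding tensorial_def
      by (simp add: lin[THEN tensorial_add] lin[THEN tensorial_smult] add_ac ring_distribs)
  qed (auto simp: form_outside[OF \<omega>] form_outside[OF \<eta>] form_smooth[OF \<omega>] form_smooth[OF \<eta>])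
  show "f \<cdot>\<^sub>s \<omega> \<in> \<Omega>" if f: "f \<in> C" and \<omega>: "\<omega> \<in> \<Omega>" for f \<omega>
  proof (rule one_formI)
    note lin = form_tensorial[OF \<omega>]
    show "tensorial VF (f \<cdot>\<^sub>s \<omega>)"
      unfolding tensorial_def
      by (simp add: lin[THEN tensorial_add] lin[THEN tensorial_smult] smult_apply mult_ac ring_distribs)
  qed (auto simp: form_outside[OF \<omega>] form_smooth[OF \<omega>] f smult_apply)
qed

lemmas form_diff_closed = submodule_diff[OF forms_submodule]

lemma ext_d_apply: "X \<in> VF \<Longrightarrow> ext_d A f X = X f"
  by (simp add: ext_d_def)

lemma ext_d_form: "f \<in> C \<Longrightarrow> ext_d A f \<in> \<Omega>"
  using VF_submodule
  by (intro one_formI) (auto simp: ext_d_def tensorial_def submodule_def smult_apply vf_smooth)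

lemma ext_d_add: "f \<in> C \<Longrightarrow> h \<in> C \<Longrightarrow> ext_d A (f + h) = ext_d A f + ext_d A h"
  by (auto simp: ext_d_def fun_eq_iff vf_add)

lemma ext_d_const: "ext_d A (\<lambda>_. c) = 0"
proof
  show "ext_d A (\<lambda>_. c) X = 0 X" for X
    using vf_const[of X c] by (cases "X \<in> VF") (simp_all only: ext_d_def if_True if_False zero_fun_apply)
qed

lemma ext_d_const_mult: "f \<in> C \<Longrightarrow> ext_d A ((\<lambda>_. c) * f) = (\<lambda>_. c) \<cdot>\<^sub>s ext_d A f"
  by (rule ext) (auto simp: ext_d_def smult_apply vf_const_mult)

lemma ext_d_mult: "f \<in> C \<Longrightarrow> h \<in> C \<Longrightarrow> ext_d A (f * h) = f \<cdot>\<^sub>s ext_d A h + h \<cdot>\<^sub>s ext_d A f"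
  by (rule ext) (auto simp: ext_d_def smult_apply vf_mult algebra_simps)

lemma lie_bracket_vf: assumes X: "X \<in> VF" and Y: "Y \<in> VF" shows "lie_bracket X Y \<in> VF"
  by (rule vector_fieldI)
    (auto simp: lie_bracket_def vf_outside[OF X] vf_outside[OF Y] vf_zero[OF X] vf_zero[OF Y]
      vf_smooth[OF X] vf_smooth[OF Y] vf_add[OF X] vf_add[OF Y] diff_smooth mult_smooth
      vf_const[OF X] vf_const[OF Y] vf_const_mult[OF X] vf_const_mult[OF Y] vf_mult[OF X] vf_mult[OF Y] algebra_simps)

lemma lie_bracket_add:
  assumes X: "X \<in> VF" and Y: "Y \<in> VF" and Z: "Z \<in> VF"
  shows "lie_bracket X (Y + Z) = lie_bracket X Y + lie_bracket X Z"
proof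
  show "lie_bracket X (Y + Z) f = (lie_bracket X Y + lie_bracket X Z) f" for f
    by (cases "f \<in> C")
      (simp_all add: lie_bracket_def vf_add[OF X] vf_smooth[OF Y] vf_smooth[OF Z] vf_outside[OF X]
        vf_outside[OF Y] vf_outside[OF Z] vf_zero[OF X] vf_zero[OF Y] vf_zero[OF Z])
qed

lemma lie_bracket_smult:
  assumes X: "X \<in> VF" and Y: "Y \<in> VF" and h: "h \<in> C"
  shows "lie_bracket X (h \<cdot>\<^sub>s Y) = h \<cdot>\<^sub>s lie_bracket X Y + X h \<cdot>\<^sub>s Y"
proof
  show "lie_bracket X (h \<cdot>\<^sub>s Y) f = (h \<cdot>\<^sub>s lie_bracket X Y + X h \<cdot>\<^sub>s Y) f" for f
    by (cases "f \<in> C")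
      (simp_all add: lie_bracket_def smult_apply vf_mult[OF X] h vf_smooth[OF Y] vf_outside[OF X]
        vf_outside[OF Y] vf_zero[OF X] vf_zero[OF Y] algebra_simps)
qed

lemma lie_bracket_swap: "lie_bracket Y X = - lie_bracket X Y"
  by (simp add: lie_bracket_def fun_eq_iff)

lemma lie_form_apply: "Y \<in> VF \<Longrightarrow> lie_form A X \<omega> Y = X (\<omega> Y) - \<omega> (lie_bracket X Y)"
  by (simp add: lie_form_def)

text \<open>
  The Lie derivative of a form is again linear over the functions: the term \<open>X h * \<omega> Y\<close>
  coming from the Leibniz rule for \<open>X (h * \<omega> Y)\<close> is cancelled by the one coming from the
  bracket \<open>[X, h Y]\<close>.
\<close>

lemma lie_form_form: assumes X: "X \<in> VF" and \<omega>: "\<omega> \<in> \<Omega>" shows "lie_form A X \<omega> \<in> \<Omega>"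
proof (rule one_formI)
  note cl = form_tensorial[OF \<omega>] and br = lie_bracket_vf[OF X]
  have VF: "\<And>Y Z. Y \<in> VF \<Longrightarrow> Z \<in> VF \<Longrightarrow> Y + Z \<in> VF" "\<And>f Y. f \<in> C \<Longrightarrow> Y \<in> VF \<Longrightarrow> f \<cdot>\<^sub>s Y \<in> VF"
    using VF_submodule by (auto simp: submodule_def)
  show "lie_form A X \<omega> Y = 0" if "Y \<notin> VF" for Y using that by (simp add: lie_form_def)
  show "lie_form A X \<omega> Y \<in> C" if "Y \<in> VF" for Y
    using that by (simp add: lie_form_apply diff_smooth vf_smooth[OF X] form_smooth[OF \<omega>] br)
  have "lie_form A X \<omega> (Y + Z) = lie_form A X \<omega> Y + lie_form A X \<omega> Z" if "Y \<in> VF" "Z \<in> VF" for Y Z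
    using that
    by (simp add: lie_form_apply VF br lie_bracket_add[OF X] tensorial_add[OF cl] vf_add[OF X] form_smooth[OF \<omega>])
  moreover have "lie_form A X \<omega> (f \<cdot>\<^sub>s Y) = f * lie_form A X \<omega> Y" if "f \<in> C" "Y \<in> VF" for f Y
    using that
    by (simp add: lie_form_apply VF br lie_bracket_smult[OF X] tensorial_add[OF cl] tensorial_smult[OF cl]
        vf_mult[OF X] form_smooth[OF \<omega>] vf_smooth[OF X] algebra_simps)
  ultimately show "tensorial VF (lie_form A X \<omega>)" by (simp add: tensorial_def)
qed

text \<open>
  The value at \<open>p\<close> of a tensorial map on a form depends only on the \<open>CARD('n)\<close> components of the form
  at \<open>p\<close>. Indeed \<open>\<rho> \<cdot>\<^sub>s \<omega>\<close> is the sum of the \<open>\<omega> (e i) \<cdot>\<^sub>s dx i\<close> globally, and tensorial maps commute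
  with multiplication by functions.
\<close>

lemma tensorial_pointwise_expansion:
  obtains \<rho> :: "'a sfun" and x :: "'n \<Rightarrow> 'a sfun" and e :: "'n \<Rightarrow> 'a vfield"
  where "\<And>i. x i \<in> C" "\<And>\<omega> X. \<omega> \<in> \<Omega> \<Longrightarrow> X \<in> VF \<Longrightarrow> \<omega> X p = (\<Sum>i\<in>UNIV. \<omega> (e i) p * X (x i) p)"
    "\<And>\<omega> F. \<omega> \<in> \<Omega> \<Longrightarrow> tensorial \<Omega> F \<Longrightarrow> F \<omega> p = (\<Sum>i\<in>UNIV. \<omega> (e i) p * F (ext_d A (x i)) p)"
proof -
  obtain \<rho> and x :: "'n \<Rightarrow> 'a sfun" and e :: "'n \<Rightarrow> 'a vfield" where fr: "\<rho> \<in> C" "\<rho> p = 1"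
    "\<And>i. x i \<in> C" "\<And>i. e i \<in> VF"
    "\<And>X f. X \<in> VF \<Longrightarrow> f \<in> C \<Longrightarrow> \<rho> * X f = (\<Sum>i\<in>UNIV. X (x i) * e i f)"
    by (rule coordinate_frame[of p]) (rule that)
  have X: "\<rho> \<cdot>\<^sub>s X = (\<Sum>i\<in>UNIV. X (x i) \<cdot>\<^sub>s e i)" if X: "X \<in> VF" for X
  proof
    fix f show "(\<rho> \<cdot>\<^sub>s X) f = (\<Sum>i\<in>UNIV. X (x i) \<cdot>\<^sub>s e i) f"
      by (cases "f \<in> C") (simp_all add: smult_apply sum_fun_apply fr X vf_outside[OF X] vf_outside[OF fr(4)])
  qed
  have \<omega>X: "\<rho> * \<omega> X = (\<Sum>i\<in>UNIV. X (x i) * \<omega> (e i))" if "\<omega> \<in> \<Omega>" "X \<in> VF" for \<omega> X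
    using X[OF that(2)] tensorial_smult[OF form_tensorial[OF that(1)] fr(1) that(2)]
      tensorial_sum[OF VF_submodule form_tensorial[OF that(1)], of UNIV "\<lambda>i. X (x i)" e]
    by (simp add: fr vf_smooth[OF that(2)])
  have \<omega>: "\<rho> \<cdot>\<^sub>s \<omega> = (\<Sum>i\<in>UNIV. \<omega> (e i) \<cdot>\<^sub>s ext_d A (x i))" if \<omega>: "\<omega> \<in> \<Omega>" for \<omega>
  proof (rule ext)
    fix X show "(\<rho> \<cdot>\<^sub>s \<omega>) X = (\<Sum>i\<in>UNIV. \<omega> (e i) \<cdot>\<^sub>s ext_d A (x i)) X"
      by (cases "X \<in> VF") (simp_all add: smult_apply sum_fun_apply \<omega>X \<omega> ext_d_def form_outside[OF \<omega>] mult.commute)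
  qed
  show thesis
  proof (rule that[of x e])
    fix \<omega> assume \<omega>1: "\<omega> \<in> \<Omega>"
    show "\<omega> X p = (\<Sum>i\<in>UNIV. \<omega> (e i) p * X (x i) p)" if "X \<in> VF" for X
      using fun_cong[OF \<omega>X[OF \<omega>1 that], of p] fr(2) by (simp add: sum_fun_apply mult.commute)
    show "F \<omega> p = (\<Sum>i\<in>UNIV. \<omega> (e i) p * F (ext_d A (x i)) p)" if F: "tensorial \<Omega> F" for F
    proof -
      have "\<rho> * F \<omega> = (\<Sum>i\<in>UNIV. \<omega> (e i) * F (ext_d A (x i)))"
        using tensorial_smult[OF F fr(1) \<omega>1] \<omega>[OF \<omega>1]
          tensorial_sum[OF forms_submodule F, of UNIV "\<lambda>i. \<omega> (e i)" "\<lambda>i. ext_d A (x i)"]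
        by (simp add: fr ext_d_form form_smooth[OF \<omega>1])
      from fun_cong[OF this, of p] show ?thesis using fr(2) by (simp add: sum_fun_apply)
    qed
  qed (use fr in auto)
qed

text \<open>
  The function that Gram-Schmidt normalizes with. As \<open>u\<close> may vanish elsewhere, it is
  composed first with a smooth function \<open>w\<close> that is positive on the whole line and is the identity near
  \<open>u p\<close>.
\<close>

lemma local_inverse_sqrt:
  assumes u: "u \<in> C" and pos: "u p > 0"
  obtains h W where "h \<in> C" "open W" "p \<in> W" "\<And>m. m \<in> W \<Longrightarrow> h m * h m * u m = 1"
proof -
  define s where "s = 4 / u p"
  have s: "s > 0" using pos by (simp add: s_def)
  \<comment> \<open>a convex combination of 1 and \<open>t\<close>, equal to 1 where \<open>t\<close> may be negative and to \<open>t\<close> above \<open>u p / 2\<close>\<close>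
  define w where "w t = cutoff (s * t) * 1 + (1 - cutoff (s * t)) * t" for t
  have id: "smooth_on UNIV (\<lambda>t::real. t)" by (rule smooth_on_linear) (rule bounded_linear_ident)
  have c: "smooth_on UNIV (\<lambda>t. cutoff (s * t))"
    by (intro smooth_on_comp[OF open_UNIV open_UNIV _ _ smooth_on_cutoff, where u = "\<lambda>t. s * t"]
        smooth_on_mult open_UNIV smooth_on_const id) auto
  have w: "smooth_on UNIV w"
    unfolding w_def[abs_def]
    by (intro smooth_on_add smooth_on_mult smooth_on_minus smooth_on_const open_UNIV c id)
  have wpos: "w t > 0" for t
  proof (cases "s * t \<le> 1")
    case True
    then show ?thesis by (simp add: w_def cutoff_one)
  next
    case False
    then have "s * t > 0" by simp
    then have t: "t > 0" using s zero_less_mult_pos by blast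
    show ?thesis
    proof (cases "cutoff (s * t) = 1")
      case False
      then have "cutoff (s * t) < 1" using cutoff_bounds(2)[of "s * t"] by simp
      then have "0 < (1 - cutoff (s * t)) * t" using t by simp
      then show ?thesis using cutoff_bounds(1)[of "s * t"] by (simp add: w_def)
    qed (simp add: w_def)
  qed
  have "smooth_on UNIV (\<lambda>t. w t powr (- 1 / 2))"
    by (rule smooth_on_comp[OF open_UNIV _ _ w smooth_on_powr]) (auto simp: wpos)
  then have 1: "(\<lambda>m. w (u m) powr (- 1 / 2)) \<in> C"
    by (intro comp_smooth[OF u open_UNIV]) auto
  have 2: "open {m. 2 < s * u m}"
    by (intro open_Collect_less continuous_intros smooth_continuous u)
  have 3: "p \<in> {m. 2 < s * u m}" using pos by (simp add: s_def)
  have 4: "w (u m) powr (- 1 / 2) * w (u m) powr (- 1 / 2) * u m = 1" if "m \<in> {m. 2 < s * u m}" for m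
  proof -
    have "w (u m) = u m" using that by (simp add: w_def cutoff_zero)
    moreover have "w (u m) powr (- 1 / 2) * w (u m) powr (- 1 / 2) = w (u m) powr (- 1 / 2 + - 1 / 2)"
      by (rule powr_add[symmetric])
    then have "w (u m) powr (- 1 / 2) * w (u m) powr (- 1 / 2) = inverse (w (u m))"
      using wpos[of "u m"] by (simp add: powr_minus)
    ultimately show ?thesis using wpos[of "u m"] by simp
  qed
  show thesis by (rule that[OF 1 2 3 4])
qed

end

section \<open>The sharp map of a Poisson tensor\<close>

locale poisson_manifold = smooth_manifold A for A :: "('a::t2_space, 'n::finite) atlas" +
  fixes P :: "'a form_tensor"
  assumes poisson: "poisson_tensor A P"
begin

abbreviation sh where "sh \<equiv> sharp A P"
abbreviation kos where "kos \<equiv> koszul A P"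

lemma P_bilinear: "sbilinear A \<Omega> P" and P_skew: "\<omega> \<in> \<Omega> \<Longrightarrow> \<eta> \<in> \<Omega> \<Longrightarrow> P \<omega> \<eta> = - P \<eta> \<omega>"
  and P_jacobi: "\<alpha> \<in> \<Omega> \<Longrightarrow> \<beta> \<in> \<Omega> \<Longrightarrow> \<gamma> \<in> \<Omega> \<Longrightarrow> schouten A P P \<alpha> \<beta> \<gamma> = 0"
  using poisson unfolding poisson_tensor_def bivector_field_def by blast+

lemmas P_tensorial = sbilinear_tensorial[OF P_bilinear]
lemmas P_smooth = sbilinear_smooth[OF P_bilinear]

lemma vf_eqI:
  assumes "X \<in> VF" "Y \<in> VF" "\<And>\<eta>. \<eta> \<in> \<Omega> \<Longrightarrow> \<eta> X = \<eta> Y" shows "X = Y"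
proof
  fix f show "X f = Y f"
    using assms(3)[OF ext_d_form, of f] assms(1,2) by (cases "f \<in> C") (simp_all add: ext_d_apply vf_outside)
qed

text \<open>
  The vector field is \<open>f \<mapsto> P \<omega> (df)\<close>. That an arbitrary form \<open>\<eta>\<close> evaluates on it to \<open>P \<omega> \<eta>\<close>, not
  only an exact one, is checked at each point by expanding \<open>\<eta>\<close> in coordinate differentials.
\<close>

lemma sharp_characterization:
  assumes \<omega>: "\<omega> \<in> \<Omega>"
  shows "sh \<omega> \<in> VF \<and> (\<forall>\<eta>\<in>\<Omega>. \<eta> (sh \<omega>) = P \<omega> \<eta>)"
proof -
  define X where "X f = (if f \<in> C then P \<omega> (ext_d A f) else 0)" for f
  note cl = P_tensorial(1)[OF \<omega>]
  have sub: "\<And>\<omega> \<eta>. \<omega> \<in> \<Omega> \<Longrightarrow> \<eta> \<in> \<Omega> \<Longrightarrow> \<omega> + \<eta> \<in> \<Omega>" "\<And>f \<omega>. f \<in> C \<Longrightarrow> \<omega> \<in> \<Omega> \<Longrightarrow> f \<cdot>\<^sub>s \<omega> \<in> \<Omega>"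
    using forms_submodule by (auto simp: submodule_def)
  have X: "X \<in> VF"
    by (rule vector_fieldI)
      (auto simp: X_def P_smooth \<omega> ext_d_form ext_d_add ext_d_const ext_d_const_mult ext_d_mult sub
        tensorial_zero[OF forms_submodule cl] smult_zero
        tensorial_add[OF cl] tensorial_smult[OF cl] algebra_simps add_smooth mult_smooth)
  have eval: "\<eta> X = P \<omega> \<eta>" if \<eta>: "\<eta> \<in> \<Omega>" for \<eta>
  proof
    fix p
    obtain x :: "'n \<Rightarrow> 'a sfun" and e :: "'n \<Rightarrow> 'a vfield" where fr: "\<And>i. x i \<in> C"
      "\<And>\<omega> X. \<omega> \<in> \<Omega> \<Longrightarrow> X \<in> VF \<Longrightarrow> \<omega> X p = (\<Sum>i\<in>UNIV. \<omega> (e i) p * X (x i) p)"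
      "\<And>\<omega> F. \<omega> \<in> \<Omega> \<Longrightarrow> tensorial \<Omega> F \<Longrightarrow> F \<omega> p = (\<Sum>i\<in>UNIV. \<omega> (e i) p * F (ext_d A (x i)) p)"
      by (rule tensorial_pointwise_expansion[of p]) (rule that)
    show "\<eta> X p = P \<omega> \<eta> p"
      by (simp add: fr(2)[OF \<eta> X] fr(3)[OF \<eta> cl] X_def fr(1))
  qed
  show ?thesis
    unfolding sharp_def
    by (rule theI2[of _ X]) (use X eval in \<open>auto intro!: vf_eqI\<close>)
qed

lemma sharp_vf [intro]: "\<omega> \<in> \<Omega> \<Longrightarrow> sh \<omega> \<in> VF"
  and form_sharp: "\<omega> \<in> \<Omega> \<Longrightarrow> \<eta> \<in> \<Omega> \<Longrightarrow> \<eta> (sh \<omega>) = P \<omega> \<eta>"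
  using sharp_characterization by auto

lemma koszul_form: "\<alpha> \<in> \<Omega> \<Longrightarrow> \<beta> \<in> \<Omega> \<Longrightarrow> kos \<alpha> \<beta> \<in> \<Omega>"
  unfolding koszul_def by (intro form_diff_closed lie_form_form ext_d_form P_smooth sharp_vf)

text \<open>
  Each term of the Schouten bracket splits into a derivative of \<open>P\<close> and a form evaluated on a
  bracket of two images of the sharp map.
\<close>

lemma P_lie_form:
  assumes a: "\<alpha> \<in> \<Omega>" and b: "\<beta> \<in> \<Omega>" and c: "\<gamma> \<in> \<Omega>"
  shows "P (lie_form A (sh \<alpha>) \<beta>) \<gamma> = sh \<alpha> (P \<beta> \<gamma>) - \<beta> (lie_bracket (sh \<gamma>) (sh \<alpha>))"
proof -
  note sa = sharp_vf[OF a] and sc = sharp_vf[OF c]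
  note L = lie_form_form[OF sa b]
  have "P (lie_form A (sh \<alpha>) \<beta>) \<gamma> = - lie_form A (sh \<alpha>) \<beta> (sh \<gamma>)"
    using P_skew[OF L c] form_sharp[OF c L] by simp
  also have "\<dots> = - sh \<alpha> (P \<gamma> \<beta>) + \<beta> (lie_bracket (sh \<alpha>) (sh \<gamma>))"
    using lie_form_apply[OF sc] form_sharp[OF c b] by simp
  also have "sh \<alpha> (P \<gamma> \<beta>) = - sh \<alpha> (P \<beta> \<gamma>)"
    using vf_uminus[OF sa P_smooth[OF b c]] P_skew[OF c b] by simp
  also have "lie_bracket (sh \<alpha>) (sh \<gamma>) = - lie_bracket (sh \<gamma>) (sh \<alpha>)" by (rule lie_bracket_swap)
  also have "\<beta> (- lie_bracket (sh \<gamma>) (sh \<alpha>)) = - \<beta> (lie_bracket (sh \<gamma>) (sh \<alpha>))"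
    by (rule tensorial_uminus[OF form_tensorial[OF b] lie_bracket_vf[OF sc sa]])
  finally show ?thesis by (simp only: minus_minus add_uminus_conv_diff)
qed

text \<open>
  The sharp map is a homomorphism of brackets; this is where the Jacobi identity enters. With
  \<open>?A\<close>, \<open>?B\<close>, \<open>?C\<close> the derivatives of \<open>P\<close> and \<open>?KA\<close>, \<open>?KB\<close>, \<open>?KC\<close> the forms on brackets, the
  vanishing of the Schouten bracket says \<open>?A + ?B + ?C = ?KA + ?KB + ?KC\<close>, while \<open>P (kos \<alpha> \<beta>) \<gamma>\<close>
  computes to \<open>?A + ?B + ?C - ?KA - ?KB\<close>.
\<close>

lemma sharp_koszul:
  assumes a: "\<alpha> \<in> \<Omega>" and b: "\<beta> \<in> \<Omega>"
  shows "sh (kos \<alpha> \<beta>) = lie_bracket (sh \<alpha>) (sh \<beta>)"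
proof (rule vf_eqI)
  note sa = sharp_vf[OF a] and sb = sharp_vf[OF b]
  show "sh (kos \<alpha> \<beta>) \<in> VF" by (intro sharp_vf koszul_form a b)
  show "lie_bracket (sh \<alpha>) (sh \<beta>) \<in> VF" by (intro lie_bracket_vf sa sb)
  fix \<gamma> assume c: "\<gamma> \<in> \<Omega>"
  note sc = sharp_vf[OF c]
  let ?A = "sh \<alpha> (P \<beta> \<gamma>)" and ?B = "sh \<beta> (P \<gamma> \<alpha>)" and ?C = "sh \<gamma> (P \<alpha> \<beta>)"
  let ?KA = "\<alpha> (lie_bracket (sh \<beta>) (sh \<gamma>))" and ?KB = "\<beta> (lie_bracket (sh \<gamma>) (sh \<alpha>))"
    and ?KC = "\<gamma> (lie_bracket (sh \<alpha>) (sh \<beta>))"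
  have jac: "?A + ?B + ?C = ?KA + ?KB + ?KC"
  proof
    fix p
    show "(?A + ?B + ?C) p = (?KA + ?KB + ?KC) p"
      using fun_cong[OF P_jacobi[OF a b c], of p]
      by (simp add: schouten_def P_lie_form a b c)
  qed
  have 1: "P (lie_form A (sh \<alpha>) \<beta>) \<gamma> = ?A - ?KB" by (rule P_lie_form[OF a b c])
  have 2: "P (lie_form A (sh \<beta>) \<alpha>) \<gamma> = - ?B + ?KA"
  proof -
    have "P (lie_form A (sh \<beta>) \<alpha>) \<gamma> = sh \<beta> (- P \<gamma> \<alpha>) - \<alpha> (- lie_bracket (sh \<beta>) (sh \<gamma>))"
      using P_lie_form[OF b a c] P_skew[OF a c] lie_bracket_swap[of "sh \<gamma>" "sh \<beta>"] by simp
    then show ?thesis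
      using vf_uminus[OF sb P_smooth[OF c a]]
        tensorial_uminus[OF form_tensorial[OF a] lie_bracket_vf[OF sb sc]] by simp
  qed
  have 3: "P (ext_d A (P \<alpha> \<beta>)) \<gamma> = - ?C"
    using P_skew[OF ext_d_form[OF P_smooth[OF a b]] c] form_sharp[OF c ext_d_form[OF P_smooth[OF a b]]]
      ext_d_apply[OF sc] by simp
  have "\<gamma> (sh (kos \<alpha> \<beta>)) = P (kos \<alpha> \<beta>) \<gamma>" by (rule form_sharp[OF koszul_form[OF a b] c])
  also have "\<dots> = (?A - ?KB) - (- ?B + ?KA) - (- ?C)"
    unfolding koszul_def
    using 1 2 3 tensorial_diff[OF forms_submodule P_tensorial(2)[OF c]] lie_form_form sa sb a b
      form_diff_closed ext_d_form P_smooth by simp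
  also have "\<dots> = ?KC" using jac by (simp add: algebra_simps)
  finally show "\<gamma> (sh (kos \<alpha> \<beta>)) = ?KC" .
qed

end

section \<open>Orthonormal coframes and the cometric\<close>

locale cometric_manifold = smooth_manifold A for A :: "('a::t2_space, 'n::finite) atlas" +
  fixes G :: "'a vfield \<Rightarrow> 'a vfield \<Rightarrow> 'a sfun" and g :: "'a form_tensor"
  assumes metric: "riemannian_metric A G" and cometric: "cometric_of A G g"
begin

lemma G_bilinear: "sbilinear A VF G" and G_sym: "X \<in> VF \<Longrightarrow> Y \<in> VF \<Longrightarrow> G X Y = G Y X"
  and G_pos: "X \<in> VF \<Longrightarrow> f \<in> C \<Longrightarrow> X f p \<noteq> 0 \<Longrightarrow> G X X p > 0"
  using metric unfolding riemannian_metric_def by blast+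

lemmas G_tensorial = sbilinear_tensorial[OF G_bilinear]
lemmas G_smooth = sbilinear_smooth[OF G_bilinear]

lemma g_bilinear: "sbilinear A \<Omega> g"
  and g_flat: "X \<in> VF \<Longrightarrow> Y \<in> VF \<Longrightarrow> g (flat A G X) (flat A G Y) = G X Y"
  using cometric unfolding cometric_of_def by blast+

lemmas g_tensorial = sbilinear_tensorial[OF g_bilinear]
lemmas g_smooth = sbilinear_smooth[OF g_bilinear]

lemma flat_form: assumes X: "X \<in> VF" shows "flat A G X \<in> \<Omega>"
  using VF_submodule G_tensorial(1)[OF X]
  by (intro one_formI) (auto simp: flat_def G_smooth X tensorial_def submodule_def)

text \<open>
  Gram-Schmidt, one field at a time. While there are fewer than \<open>CARD('n)\<close> fields, some
  coordinate vector \<open>w\<close> is outside the span of the coordinate vectors of those already chosen. The field with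
  constant coefficients \<open>w\<close>, minus its projections, is therefore nonzero at \<open>p\<close> and can be
  normalized near \<open>p\<close>.
\<close>

lemma orthonormal_fields:
  assumes "finite I" "I \<subseteq> (UNIV :: 'n set)"
  shows "\<exists>u W. (\<forall>i\<in>I. u i \<in> VF) \<and> open W \<and> p \<in> W \<and>
    (\<forall>m\<in>W. \<forall>i\<in>I. \<forall>j\<in>I. G (u i) (u j) m = (if i = j then 1 else 0))"
  using assms
proof (induction I rule: finite_induct)
  case empty
  show ?case by (rule exI, rule exI[of _ UNIV]) auto
next
  case (insert k I)
  obtain u W where u: "\<And>i. i \<in> I \<Longrightarrow> u i \<in> VF" and W: "open W" "p \<in> W"
    and on: "\<And>m i j. m \<in> W \<Longrightarrow> i \<in> I \<Longrightarrow> j \<in> I \<Longrightarrow> G (u i) (u j) m = (if i = j then 1 else 0)"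
    using insert by blast
  obtain x :: "'n \<Rightarrow> 'a sfun" and e :: "'n \<Rightarrow> 'a vfield" where fr: "\<And>i. x i \<in> C" "\<And>i. e i \<in> VF"
    "\<And>i j. e i (x j) p = (if i = j then 1 else 0)"
    by (rule coordinate_frame[of p]) (rule that)
  define v :: "'n \<Rightarrow> real ^ 'n" where "v i = (\<chi> j. u i (x j) p)" for i
  have "card I < CARD('n)"
    using insert(1,2) psubset_card_mono[of "UNIV :: 'n set" I] by auto
  moreover have "dim (span (v ` I)) \<le> card I"
    using dim_le_card[of "span (v ` I)" "v ` I"] card_image_le[OF insert(1), of v] insert(1) by force
  ultimately have "span (v ` I) \<noteq> UNIV"
    by (metis dim_UNIV DIM_cart DIM_real mult.right_neutral not_le)
  then obtain w where w: "w \<notin> span (v ` I)" by blast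
  define Y where "Y = (\<Sum>j\<in>UNIV. (\<lambda>_. w $ j) \<cdot>\<^sub>s e j)"
  have Y: "Y \<in> VF" unfolding Y_def by (intro submodule_sum[OF VF_submodule] const_smooth fr)
  have Yx: "Y (x j) p = w $ j" for j
    by (simp add: Y_def sum_fun_apply smult_apply fr(3) if_distrib cong: if_cong)
  define S where "S = (\<Sum>i\<in>I. G Y (u i) \<cdot>\<^sub>s u i)"
  have S: "S \<in> VF" unfolding S_def by (intro submodule_sum[OF VF_submodule] G_smooth Y u)
  define Z where "Z = Y - S"
  have Z: "Z \<in> VF" unfolding Z_def by (rule submodule_diff[OF VF_submodule Y S])
  have "\<exists>j. Z (x j) p \<noteq> 0"
  proof (rule ccontr)
    assume "\<nexists>j. Z (x j) p \<noteq> 0"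
    then have "w $ j = (\<Sum>i\<in>I. G Y (u i) p * u i (x j) p)" for j
      using Yx[of j] by (simp add: Z_def S_def sum_fun_apply smult_apply)
    then have "w = (\<Sum>i\<in>I. G Y (u i) p *\<^sub>R v i)" by (simp add: vec_eq_iff v_def)
    then have "w \<in> span (v ` I)" by (simp add: span_sum span_scale span_base)
    with w show False by simp
  qed
  then have pos: "G Z Z p > 0" using G_pos[OF Z fr(1)] by blast
  obtain h W' where h: "h \<in> C" and W': "open W'" "p \<in> W'"
    and norm: "\<And>m. m \<in> W' \<Longrightarrow> h m * h m * G Z Z m = 1"
    using local_inverse_sqrt[OF G_smooth[OF Z Z] pos] by blast
  define y where "y = h \<cdot>\<^sub>s Z"
  have y: "y \<in> VF" using VF_submodule h Z unfolding y_def submodule_def by blast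
  have Zu: "G Z (u i) m = 0" if "m \<in> W" "i \<in> I" for m i
  proof -
    note cl = G_tensorial(2)[OF u[OF that(2)]]
    have "G Z (u i) = G Y (u i) - (\<Sum>l\<in>I. G Y (u l) * G (u l) (u i))"
      unfolding Z_def tensorial_diff[OF VF_submodule cl Y S]
      unfolding S_def by (subst tensorial_sum[OF VF_submodule cl]) (auto simp: G_smooth Y u)
    then show ?thesis
      using that insert(1) by (simp add: sum_fun_apply on if_distrib cong: if_cong)
  qed
  have yu: "G y (u i) m = 0" "G (u i) y m = 0" if "m \<in> W" "i \<in> I" for m i
  proof -
    have "G y (u i) = h * G Z (u i)"
      unfolding y_def by (rule tensorial_smult[OF G_tensorial(2)[OF u[OF that(2)]] h Z])
    then show "G y (u i) m = 0" using Zu[OF that] by simp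
    then show "G (u i) y m = 0" using G_sym[OF y u[OF that(2)]] by simp
  qed
  have yy: "G y y m = 1" if "m \<in> W'" for m
    using norm[OF that] tensorial_smult[OF G_tensorial(2)[OF y] h Z] tensorial_smult[OF G_tensorial(1)[OF Z] h Z]
    by (simp add: y_def mult.assoc)
  show ?case
  proof (intro exI conjI)
    show "\<forall>i\<in>insert k I. (u(k := y)) i \<in> VF" using u y by auto
    show "open (W \<inter> W')" "p \<in> W \<inter> W'" using W W' by auto
    show "\<forall>m\<in>W \<inter> W'. \<forall>i\<in>insert k I. \<forall>j\<in>insert k I.
        G ((u(k := y)) i) ((u(k := y)) j) m = (if i = j then 1 else 0)"
      using insert(2) on yu yy by auto
  qed
qed

lemma local_orthonormal_coframe_exists: "\<exists>\<theta>. local_orthonormal_coframe A g p \<theta>"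
proof -
  obtain u :: "'n \<Rightarrow> 'a vfield" and W where uW: "(\<forall>i\<in>UNIV. u i \<in> VF) \<and> open W \<and> p \<in> W \<and>
      (\<forall>m\<in>W. \<forall>i\<in>UNIV. \<forall>j\<in>UNIV. G (u i) (u j) m = (if i = j then 1 else 0))"
    using orthonormal_fields[OF finite_class.finite_UNIV subset_UNIV, of p] by (elim exE) (rule that)
  then have "local_orthonormal_coframe A g p (\<lambda>i. flat A G (u i))"
    unfolding local_orthonormal_coframe_def by (auto simp: flat_form g_flat intro!: exI[of _ W])
  then show ?thesis by blast
qed

text \<open>
  The coefficients \<open>c\<close> represent \<open>\<omega>\<close> at \<open>p\<close> in the coframe: every tensorial map sees only them. The map
  \<open>T\<close> sends coefficients to the components of the combination; a combination with zero components is
  orthogonal to the whole coframe, so \<open>T\<close> is injective, and by equality of dimensions it is onto.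
\<close>

lemma coframe_spans:
  assumes \<theta>: "local_orthonormal_coframe A g p \<theta>" and \<omega>: "\<omega> \<in> \<Omega>"
  obtains c where "\<And>F. tensorial \<Omega> F \<Longrightarrow> F \<omega> p = (\<Sum>j\<in>UNIV. c j * F (\<theta> j) p)"
proof -
  have t: "\<theta> j \<in> \<Omega>" for j using \<theta> by (simp add: local_orthonormal_coframe_def)
  have on: "g (\<theta> i) (\<theta> j) p = (if i = j then 1 else 0)" for i j
    using \<theta> unfolding local_orthonormal_coframe_def by blast
  obtain x :: "'n \<Rightarrow> 'a sfun" and e :: "'n \<Rightarrow> 'a vfield" where ex: "\<And>\<omega> F. \<omega> \<in> \<Omega> \<Longrightarrow> tensorial \<Omega> F \<Longrightarrow> F \<omega> p = (\<Sum>i\<in>UNIV. \<omega> (e i) p * F (ext_d A (x i)) p)"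
    by (rule tensorial_pointwise_expansion[of p]) (rule that)
  define comb where "comb c = (\<Sum>j\<in>UNIV. (\<lambda>_. c $ j) \<cdot>\<^sub>s \<theta> j)" for c :: "real ^ 'n"
  have comb: "comb c \<in> \<Omega>" for c
    unfolding comb_def by (intro submodule_sum[OF forms_submodule] const_smooth t)
  have F_comb: "F (comb c) p = (\<Sum>j\<in>UNIV. c $ j * F (\<theta> j) p)" if "tensorial \<Omega> F" for F c
    unfolding comb_def using tensorial_sum[OF forms_submodule that, of UNIV "\<lambda>j _. c $ j" \<theta>]
    by (simp add: t sum_fun_apply)
  define T :: "real ^ 'n \<Rightarrow> real ^ 'n" where "T c = (\<chi> i. comb c (e i) p)" for c
  have T: "T c = (\<chi> i. \<Sum>j\<in>UNIV. c $ j * \<theta> j (e i) p)" for c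
    by (simp add: T_def comb_def sum_fun_apply smult_apply)
  have lin: "linear T"
    by (rule linearI) (simp_all add: T vec_eq_iff sum.distrib sum_distrib_left algebra_simps)
  have "inj T"
  proof (rule linear_injective_0[OF lin, THEN iffD2], intro allI impI)
    fix c assume "T c = 0"
    then have "comb c (e i) p = 0" for i by (simp add: T_def vec_eq_iff)
    then have "g (comb c) (\<theta> k) p = 0" for k
      using ex[OF comb g_tensorial(2)[OF t]] by simp
    then have "c $ k = 0" for k
      using F_comb[OF g_tensorial(2)[OF t[of k]], of c] by (simp add: on if_distrib cong: if_cong)
    then show "c = 0" by (simp add: vec_eq_iff)
  qed
  then have "surj T" using linear_injective_imp_surjective[OF lin] by simp
  then obtain c where "T c = (\<chi> i. \<omega> (e i) p)" by (metis surjD)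
  then have eq: "comb c (e i) p = \<omega> (e i) p" for i by (simp add: T_def vec_eq_iff)
  have "F \<omega> p = (\<Sum>j\<in>UNIV. c $ j * F (\<theta> j) p)" if "tensorial \<Omega> F" for F
    using ex[OF \<omega> that] ex[OF comb that, of c] F_comb[OF that, of c] by (simp add: eq)
  then show thesis by (rule that)
qed

text \<open>
  Parseval's identity. The cometric is prescribed only on flattened vector fields; its symmetry and
  positivity on all forms are read off from this expansion.
\<close>

lemma g_coframe_expansion:
  assumes \<theta>: "local_orthonormal_coframe A g p \<theta>" and \<omega>: "\<omega> \<in> \<Omega>" and \<eta>: "\<eta> \<in> \<Omega>"
  shows "g \<omega> \<eta> p = (\<Sum>j\<in>UNIV. g \<omega> (\<theta> j) p * g \<eta> (\<theta> j) p)"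
proof -
  have t: "\<theta> j \<in> \<Omega>" for j using \<theta> by (simp add: local_orthonormal_coframe_def)
  have on: "g (\<theta> i) (\<theta> j) p = (if i = j then 1 else 0)" for i j
    using \<theta> unfolding local_orthonormal_coframe_def by blast
  obtain c where c: "\<And>F. tensorial \<Omega> F \<Longrightarrow> F \<eta> p = (\<Sum>j\<in>UNIV. c j * F (\<theta> j) p)"
    using coframe_spans[OF \<theta> \<eta>] by blast
  have "g \<eta> (\<theta> k) p = c k" for k
    using c[OF g_tensorial(2)[OF t]] by (simp add: on if_distrib cong: if_cong)
  then show ?thesis using c[OF g_tensorial(1)[OF \<omega>]] by (simp add: mult.commute)
qed

lemma g_sym: assumes "\<omega> \<in> \<Omega>" "\<eta> \<in> \<Omega>" shows "g \<omega> \<eta> = g \<eta> \<omega>"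
proof
  fix p
  obtain \<theta> where \<theta>: "local_orthonormal_coframe A g p \<theta>"
    using local_orthonormal_coframe_exists by blast
  show "g \<omega> \<eta> p = g \<eta> \<omega> p"
    using g_coframe_expansion[OF \<theta> assms] g_coframe_expansion[OF \<theta> assms(2,1)] by (simp add: mult.commute)
qed

lemma g_nonneg: assumes "\<omega> \<in> \<Omega>" shows "g \<omega> \<omega> p \<ge> 0"
proof -
  obtain \<theta> where \<theta>: "local_orthonormal_coframe A g p \<theta>"
    using local_orthonormal_coframe_exists by blast
  show ?thesis using g_coframe_expansion[OF \<theta> assms assms] by (simp add: sum_nonneg)
qed

lemma g_null: assumes "\<omega> \<in> \<Omega>" "\<eta> \<in> \<Omega>" "g \<omega> \<omega> p = 0" shows "g \<omega> \<eta> p = 0"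
proof -
  obtain \<theta> where \<theta>: "local_orthonormal_coframe A g p \<theta>"
    using local_orthonormal_coframe_exists by blast
  have "g \<omega> (\<theta> j) p = 0" for j
    using g_coframe_expansion[OF \<theta> assms(1,1)] assms(3)
    by (simp add: sum_nonneg_eq_0_iff)
  then show ?thesis using g_coframe_expansion[OF \<theta> assms(1,2)] by simp
qed

lemma g_definite: assumes \<omega>: "\<omega> \<in> \<Omega>" and z: "g \<omega> \<omega> = 0" shows "\<omega> = 0"
proof (intro ext)
  fix X p
  show "\<omega> X p = 0 X p"
  proof (cases "X \<in> VF")
    case True
    obtain \<theta> where \<theta>: "local_orthonormal_coframe A g p \<theta>"
      using local_orthonormal_coframe_exists by blast
    have t: "\<theta> j \<in> \<Omega>" for j using \<theta> by (simp add: local_orthonormal_coframe_def)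
    have on: "g (\<theta> i) (\<theta> j) p = (if i = j then 1 else 0)" for i j
      using \<theta> unfolding local_orthonormal_coframe_def by blast
    obtain c where c: "\<And>F. tensorial \<Omega> F \<Longrightarrow> F \<omega> p = (\<Sum>j\<in>UNIV. c j * F (\<theta> j) p)"
      using coframe_spans[OF \<theta> \<omega>] by blast
    have "c k = 0" for k
      using c[OF g_tensorial(2)[OF t], of k] g_null[OF \<omega> t, of p k] z by (simp add: on if_distrib cong: if_cong)
    moreover have "tensorial \<Omega> (\<lambda>\<omega>. \<omega> X)" by (simp add: tensorial_def smult_apply)
    ultimately show ?thesis using c[of "\<lambda>\<omega>. \<omega> X"] by simp
  qed (simp add: form_outside[OF \<omega>])
qed

end

section \<open>The 2-Killing equation and the curvature\<close>

locale riemannian_poisson_manifold = cometric_manifold A G g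
  for A :: "('a::t2_space, 'n::finite) atlas" and G g +
  fixes P :: "'a form_tensor" and D :: "'a form_conn"
  assumes riemannian_poisson: "riemannian_poisson A G g P D"
begin

sublocale poisson_manifold A P
  using riemannian_poisson by unfold_locales (simp add: riemannian_poisson_def)

lemma D_form [intro]: "\<alpha> \<in> \<Omega> \<Longrightarrow> \<beta> \<in> \<Omega> \<Longrightarrow> D \<alpha> \<beta> \<in> \<Omega>"
  and D_add: "\<alpha> \<in> \<Omega> \<Longrightarrow> \<beta> \<in> \<Omega> \<Longrightarrow> \<gamma> \<in> \<Omega> \<Longrightarrow> D (\<alpha> + \<beta>) \<gamma> = D \<alpha> \<gamma> + D \<beta> \<gamma>"
  and D_smult: "f \<in> C \<Longrightarrow> \<alpha> \<in> \<Omega> \<Longrightarrow> \<beta> \<in> \<Omega> \<Longrightarrow> D (f \<cdot>\<^sub>s \<alpha>) \<beta> = f \<cdot>\<^sub>s D \<alpha> \<beta>"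
  and D_torsion: "\<alpha> \<in> \<Omega> \<Longrightarrow> \<beta> \<in> \<Omega> \<Longrightarrow> kos \<alpha> \<beta> = D \<alpha> \<beta> - D \<beta> \<alpha>"
  and D_metric: "\<alpha> \<in> \<Omega> \<Longrightarrow> \<beta> \<in> \<Omega> \<Longrightarrow> \<gamma> \<in> \<Omega> \<Longrightarrow> sh \<alpha> (g \<beta> \<gamma>) = g (D \<alpha> \<beta>) \<gamma> + g \<beta> (D \<alpha> \<gamma>)"
  using riemannian_poisson
  unfolding riemannian_poisson_def contravariant_levi_civita_def contravariant_connection_def
  by auto

text \<open>
  Torsion-freeness replaces the bracket by \<open>D \<eta> \<alpha> - D \<alpha> \<eta>\<close>; metricity cancels the terms that
  differentiate along \<open>\<eta>\<close>. So \<open>lie_tensor A P \<eta> g\<close> is twice the symmetric part of \<open>\<alpha> \<mapsto> D \<alpha> \<eta>\<close>.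
\<close>

lemma lie_cometric:
  assumes e: "\<eta> \<in> \<Omega>" and a: "\<alpha> \<in> \<Omega>" and b: "\<beta> \<in> \<Omega>"
  shows "lie_tensor A P \<eta> g \<alpha> \<beta> = g (D \<alpha> \<eta>) \<beta> + g \<alpha> (D \<beta> \<eta>)"
proof -
  note d = tensorial_diff[OF forms_submodule]
  have "g (D \<eta> \<alpha> - D \<alpha> \<eta>) \<beta> = g (D \<eta> \<alpha>) \<beta> - g (D \<alpha> \<eta>) \<beta>"
    by (rule d[OF g_tensorial(2)[OF b]]) (use e a in auto)
  moreover have "g \<alpha> (D \<eta> \<beta> - D \<beta> \<eta>) = g \<alpha> (D \<eta> \<beta>) - g \<alpha> (D \<beta> \<eta>)"
    by (rule d[OF g_tensorial(1)[OF a]]) (use e b in auto)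
  ultimately show ?thesis
    by (simp add: lie_tensor_def D_torsion D_metric e a b)
qed

text \<open>
  The 2-Killing equation evaluated on the pair \<open>\<alpha>, \<alpha>\<close>, solved for the square norm that arises from the
  part \<open>- D \<alpha> \<eta>\<close> of the bracket of \<open>\<eta>\<close> and \<open>\<alpha>\<close>.
\<close>

lemma two_killing_norm:
  assumes k: "two_killing A P g \<eta>" and a: "\<alpha> \<in> \<Omega>"
  shows "g (D \<alpha> \<eta>) (D \<alpha> \<eta>) =
    g \<alpha> (D (kos \<eta> \<alpha>) \<eta>) + g (D \<eta> \<alpha>) (D \<alpha> \<eta>) - sh \<eta> (g \<alpha> (D \<alpha> \<eta>))"
proof -
  have e: "\<eta> \<in> \<Omega>" using k by (simp add: two_killing_def)
  let ?S = "D \<alpha> \<eta>" and ?b = "kos \<eta> \<alpha>"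
  have S: "?S \<in> \<Omega>" and b: "?b \<in> \<Omega>" and T: "D ?b \<eta> \<in> \<Omega>" and na: "D \<eta> \<alpha> \<in> \<Omega>"
    using e a koszul_form by auto
  have "lie_tensor A P \<eta> (lie_tensor A P \<eta> g) \<alpha> \<alpha> = 0"
    using k a by (simp add: two_killing_def)
  then have 0: "sh \<eta> (g ?S \<alpha> + g \<alpha> ?S) - (g (D ?b \<eta>) \<alpha> + g ?b ?S) - (g ?S ?b + g \<alpha> (D ?b \<eta>)) = 0"
    by (simp add: lie_tensor_def[of A P \<eta> "lie_tensor A P \<eta> g"] lie_cometric e a b)
  have gb: "g ?b ?S = g (D \<eta> \<alpha>) ?S - g ?S ?S"
    unfolding D_torsion[OF e a] by (rule tensorial_diff[OF forms_submodule g_tensorial(2)[OF S] na S])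
  have sum: "sh \<eta> (g ?S \<alpha> + g \<alpha> ?S) = sh \<eta> (g \<alpha> ?S) + sh \<eta> (g \<alpha> ?S)"
    using vf_add[OF sharp_vf[OF e] g_smooth[OF S a] g_smooth[OF a S]] g_sym[OF S a] by simp
  show ?thesis
  proof
    fix p
    show "g ?S ?S p = (g \<alpha> (D ?b \<eta>) + g (D \<eta> \<alpha>) ?S - sh \<eta> (g \<alpha> ?S)) p"
      using fun_cong[OF 0, of p] g_sym[OF T a] g_sym[OF S b]
      by (simp add: sum gb)
  qed
qed

text \<open>
  Metricity moves all derivatives in \<open>g (R (\<eta>, \<alpha>) \<alpha>, \<eta>)\<close> from \<open>\<alpha>\<close> to \<open>\<eta>\<close>. The second derivatives of the
  function \<open>g \<alpha> \<eta>\<close> cancel because the sharp map respects brackets, the terms with \<open>D \<eta> \<eta>\<close>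
  vanish, and the rest is the right-hand side of \<open>two_killing_norm\<close>.
\<close>

lemma two_killing_curvature:
  assumes k: "two_killing A P g \<eta>" and geo: "D \<eta> \<eta> = 0" and a: "\<alpha> \<in> \<Omega>"
  shows "g (curvature A P D \<eta> \<alpha> \<alpha>) \<eta> = g (D \<alpha> \<eta>) (D \<alpha> \<eta>)"
proof -
  have e: "\<eta> \<in> \<Omega>" using k by (simp add: two_killing_def)
  let ?S = "D \<alpha> \<eta>" and ?b = "kos \<eta> \<alpha>" and ?f = "g \<alpha> \<eta>"
  note forms = e a koszul_form[OF e a] D_form
  note se = sharp_vf[OF e] and sa = sharp_vf[OF a]
  have g0: "g \<beta> 0 = 0" if "\<beta> \<in> \<Omega>" for \<beta>
    by (rule tensorial_zero[OF forms_submodule g_tensorial(1)[OF that]])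
  have f: "?f \<in> C" by (rule g_smooth[OF a e])
  have "sh \<eta> (g (D \<alpha> \<alpha>) \<eta>) = g (D \<eta> (D \<alpha> \<alpha>)) \<eta>"
    using D_metric[of \<eta> "D \<alpha> \<alpha>" \<eta>] by (simp add: forms geo g0)
  moreover have "sh \<alpha> ?f = g (D \<alpha> \<alpha>) \<eta> + g \<alpha> ?S" by (rule D_metric[OF a a e])
  then have "g (D \<alpha> \<alpha>) \<eta> = sh \<alpha> ?f - g \<alpha> ?S" by simp
  ultimately have 1: "g (D \<eta> (D \<alpha> \<alpha>)) \<eta> = sh \<eta> (sh \<alpha> ?f) - sh \<eta> (g \<alpha> ?S)"
    using vf_diff[OF se, of "sh \<alpha> ?f" "g \<alpha> ?S"] by (simp add: vf_smooth[OF sa f] g_smooth forms)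
  have "g (D \<eta> \<alpha>) \<eta> = sh \<eta> ?f"
    using D_metric[of \<eta> \<alpha> \<eta>] by (simp add: forms geo g0)
  then have 2: "g (D \<alpha> (D \<eta> \<alpha>)) \<eta> = sh \<alpha> (sh \<eta> ?f) - g (D \<eta> \<alpha>) ?S"
    using D_metric[of \<alpha> "D \<eta> \<alpha>" \<eta>] by (simp add: forms)
  have 3: "g (D ?b \<alpha>) \<eta> = sh \<eta> (sh \<alpha> ?f) - sh \<alpha> (sh \<eta> ?f) - g \<alpha> (D ?b \<eta>)"
    using D_metric[of ?b \<alpha> \<eta>] sharp_koszul[OF e a] by (simp add: forms lie_bracket_def)
  have "g (curvature A P D \<eta> \<alpha> \<alpha>) \<eta> =
      g (D \<eta> (D \<alpha> \<alpha>)) \<eta> - g (D \<alpha> (D \<eta> \<alpha>)) \<eta> - g (D ?b \<alpha>) \<eta>"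
    unfolding curvature_def
    by (simp add: tensorial_diff[OF forms_submodule g_tensorial(2)[OF e]] forms form_diff_closed)
  also have "\<dots> = g \<alpha> (D ?b \<eta>) + g (D \<eta> \<alpha>) ?S - sh \<eta> (g \<alpha> ?S)"
    unfolding 1 2 3 by (simp add: algebra_simps)
  also have "\<dots> = g ?S ?S" by (rule two_killing_norm[OF k a, symmetric])
  finally show ?thesis .
qed

text \<open>
  Summing the curvature identity over the coframe picked in the definition of \<open>ricci\<close> exhibits
  the Ricci curvature as a sum of squares. Being nonpositive, it forces \<open>D (\<theta> i) \<eta>\<close> to vanish at
  the point for all \<open>i\<close>, and then \<open>D \<alpha> \<eta>\<close> too, because it is tensorial in \<open>\<alpha>\<close>.
\<close>

lemma geodesic_two_killing_parallel:
  assumes k: "two_killing A P g \<eta>" and geo: "D \<eta> \<eta> = 0" and ric: "\<And>p. ricci A P g D \<eta> \<eta> p \<le> 0"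
  shows "parallel_form A D \<eta>"
  unfolding parallel_form_def
proof
  fix \<alpha> assume a: "\<alpha> \<in> \<Omega>"
  have e: "\<eta> \<in> \<Omega>" using k by (simp add: two_killing_def)
  have "g (D \<alpha> \<eta>) (D \<alpha> \<eta>) p = 0" for p
  proof -
    define \<theta> where "\<theta> = (SOME \<theta>. local_orthonormal_coframe A g p \<theta>)"
    have \<theta>: "local_orthonormal_coframe A g p \<theta>"
      unfolding \<theta>_def using local_orthonormal_coframe_exists by (rule someI_ex)
    then have t: "\<theta> j \<in> \<Omega>" for j by (simp add: local_orthonormal_coframe_def)
    have "(\<Sum>i\<in>UNIV. g (D (\<theta> i) \<eta>) (D (\<theta> i) \<eta>) p) = ricci A P g D \<eta> \<eta> p"
      by (simp add: ricci_def Let_def two_killing_curvature[OF k geo] t flip: \<theta>_def)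
    also have "\<dots> \<le> 0" by (rule ric)
    finally have "(\<Sum>i\<in>UNIV. g (D (\<theta> i) \<eta>) (D (\<theta> i) \<eta>) p) = 0"
      by (intro antisym sum_nonneg g_nonneg D_form t e)
    then have "g (D (\<theta> i) \<eta>) (D (\<theta> i) \<eta>) p = 0" for i
      using sum_nonneg_eq_0_iff[of UNIV "\<lambda>i. g (D (\<theta> i) \<eta>) (D (\<theta> i) \<eta>) p"]
        g_nonneg[OF D_form[OF t e]] by simp
    then have z: "g (D (\<theta> i) \<eta>) (D \<alpha> \<eta>) p = 0" for i
      by (rule g_null[OF D_form[OF t e] D_form[OF a e]])
    have "tensorial \<Omega> (\<lambda>\<beta>. g (D \<beta> \<eta>) (D \<alpha> \<eta>))"
      unfolding tensorial_def
      by (simp add: D_add D_smult e a D_form tensorial_add[OF g_tensorial(2)] tensorial_smult[OF g_tensorial(2)])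
    then show ?thesis
      using coframe_spans[OF \<theta> a] z by (metis (no_types, lifting) mult_zero_right sum.neutral)
  qed
  then have "g (D \<alpha> \<eta>) (D \<alpha> \<eta>) = 0" by (simp add: fun_eq_iff)
  then show "D \<alpha> \<eta> = 0" by (rule g_definite[OF D_form[OF a e]])
qed

end

theorem theorem4p3:
  fixes A :: "('a::{t2_space, second_countable_topology}, 'n::finite) atlas"
    and G :: "'a vfield \<Rightarrow> 'a vfield \<Rightarrow> 'a sfun"
    and g P :: "'a form_tensor"
    and D :: "'a form_conn"
    and \<eta> :: "'a form"
  assumes "smooth_atlas A"
    and "compact (UNIV :: 'a set)"
    and "riemannian_poisson A G g P D"
    and "two_killing A P g \<eta>"
    and "D \<eta> \<eta> = 0"
    and "\<forall>p. ricci A P g D \<eta> \<eta> p \<le> 0"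
  shows "parallel_form A D \<eta>"
proof -
  interpret riemannian_poisson_manifold A G g P D
    using assms(1,3) by unfold_locales (simp_all add: riemannian_poisson_def)
  show ?thesis
    using assms(4-6) by (intro geodesic_two_killing_parallel) auto
qed

end
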